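(* Let $k\ge 2$ be an integer. Suppose that $Y\ge 0$ is a random variable with $\log\mathbb{P}\{Y\ge x\}=-\alpha x+o(x)$ as $x\to\infty$, for some $\alpha\in(0,\infty)$. Let $\varepsilon,\delta>0$. Then there exist constants $c,c'\in(0,\infty)$ such that, for all $m$ large enough, $$c\, e^{-k\alpha\varepsilon(1+\delta)m}\le\mathbb{P}\{M_m\ge(\gamma+\varepsilon)m\}\le c'\,e^{-k\alpha\varepsilon(1-\delta)m},$$ where $M_m$ is the minimum position at level $m$ of the branching random walk with constant branching factor $k$ and step distribution $Y$, and $\gamma=\inf\{z\le\mathbb{E}[Y]:\Lambda^\star(z)<\log k\}$.
   Context: $\log$ is the natural logarithm. Branching random walk with branching factor $k$ and step distribution $Y$: let $\mathcal{A}=\{1,\dots,k\}$ and let $\mathcal{U}=\bigcup_{m\ge0}\mathcal{A}^m$ be the set of finite words on $\mathcal{A}$, viewed as the complete $k$-ary tree, with $v\preceq u$ meaning that $v$ is a prefix of $u$. Let $Y_u$, $u\in\mathcal{U}\setminus\{\varnothing\}$, be i.i.d. copies of $Y$, and $Y_\varnothing=0$. The position of $u$ is $S_u=\sum_{v\preceq u}Y_v$, and $M_m=\min\{S_u:u\in\mathcal{A}^m\}$. $\Lambda(\lambda)=\log\mathbb{E}[e^{\lambda Y}]\in(-\infty,+\infty]$ for $\lambda\in\mathbb{R}$, and $\Lambda^\star(z)=\sup_{\lambda\in\mathbb{R}}\{\lambda z-\Lambda(\lambda)\}$. *)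

theory Defs
  imports "HOL-Probability.Probability" "HOL-Library.Sublist" "HOL-Library.Landau_Symbols"
begin

definition level :: "nat \<Rightarrow> nat \<Rightarrow> nat list set" where
  "level k m = {u. length u = m \<and> set u \<subseteq> {1..k}}"

definition words :: "nat \<Rightarrow> nat list set" where
  "words k = (\<Union>m. level k m)"

text \<open>The step variable \<open>Y\<close> lives on \<open>N\<close>; the walk, with displacements \<open>X u\<close> at the nodes
  \<open>u\<close>, may live on a different probability space \<open>P\<close>. Independence includes measurability
  of each \<open>X u\<close>.\<close>

definition branching_random_walk ::
    "nat \<Rightarrow> 'a measure \<Rightarrow> ('a \<Rightarrow> real) \<Rightarrow> 'b measure \<Rightarrow> (nat list \<Rightarrow> 'b \<Rightarrow> real) \<Rightarrow> bool" where
  "branching_random_walk k N Y P X \<longleftrightarrow>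
     prob_space P \<and>
     prob_space.indep_vars P (\<lambda>_. borel) X (words k - {[]}) \<and>
     (\<forall>u \<in> words k - {[]}. distr P borel (X u) = distr N borel Y) \<and>
     (\<forall>\<omega> \<in> space P. X [] \<omega> = 0)"

definition position :: "(nat list \<Rightarrow> 'b \<Rightarrow> real) \<Rightarrow> nat list \<Rightarrow> 'b \<Rightarrow> real" where
  "position X u \<omega> = (\<Sum>v | prefix v u. X v \<omega>)"

definition min_position :: "nat \<Rightarrow> (nat list \<Rightarrow> 'b \<Rightarrow> real) \<Rightarrow> nat \<Rightarrow> 'b \<Rightarrow> real" where
  "min_position k X m \<omega> = Min ((\<lambda>u. position X u \<omega>) ` level k m)"

definition log_mgf :: "'a measure \<Rightarrow> ('a \<Rightarrow> real) \<Rightarrow> real \<Rightarrow> ereal" where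
  "log_mgf N Y l =
     (let E = \<integral>\<^sup>+ \<omega>. ennreal (exp (l * Y \<omega>)) \<partial>N
      in if E = \<infinity> then \<infinity> else ereal (ln (enn2real E)))"

definition rate_function :: "'a measure \<Rightarrow> ('a \<Rightarrow> real) \<Rightarrow> real \<Rightarrow> ereal" where
  "rate_function N Y z = (SUP l::real. ereal (l * z) - log_mgf N Y l)"

text \<open>\<open>Inf\<close> on the reals is only meaningful for a nonempty set that is bounded below. This
  holds when \<open>Y\<close> is nonnegative and integrable and \<open>k \<ge> 2\<close>: the rate function is \<open>0\<close> at the
  mean and \<open>\<infinity>\<close> on the negative half-line.\<close>

definition speed :: "nat \<Rightarrow> 'a measure \<Rightarrow> ('a \<Rightarrow> real) \<Rightarrow> real" where
  "speed k N Y =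
     Inf {z. z \<le> integral\<^sup>L N Y \<and> rate_function N Y z < ereal (ln (real k))}"

text \<open>The condition \<open>log P(Y \<ge> x) = - \<alpha> x + o(x)\<close>. The convention \<open>ln 0 = 0\<close> does no harm for
  \<open>\<alpha> > 0\<close>: if the probability vanished for large \<open>x\<close>, the condition would demand that
  \<open>\<alpha> x\<close> be \<open>o(x)\<close>.\<close>

definition exponential_tail :: "'a measure \<Rightarrow> ('a \<Rightarrow> real) \<Rightarrow> real \<Rightarrow> bool" where
  "exponential_tail N Y \<alpha> \<longleftrightarrow>
     (\<lambda>x. ln (measure N {\<omega> \<in> space N. Y \<omega> \<ge> x}) - (- \<alpha> * x)) \<in> o[at_top](\<lambda>x::real. x)"

end

theory Submission
  imports Defs "HOL-Real_Asymp.Real_Asymp"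
begin

text \<open>
  Conditioning on the first generation gives \<open>P(M\<^sub>m\<^sub>+\<^sub>1 \<ge> x) = P(Y + M\<^sub>m \<ge> x)\<^sup>k\<close>, so that
  \<open>q\<^sub>m(x) = P(M\<^sub>m \<ge> x)\<close> is an explicit recursion for functions on the line (\<open>tail\<close> below) and the
  tree can be forgotten.

  Lower bound: all \<open>k\<close> children of the root are displaced by about \<open>\<epsilon> m\<close>, at cost
  \<open>exp (- k \<alpha> \<epsilon> m)\<close>, and every subtree behaves typically, since a first moment bound gives
  \<open>q\<^sub>m(z m) \<rightarrow> 1\<close> for \<open>z < \<gamma>\<close>.

  Upper bound: for \<open>w > \<gamma>\<close> one has \<open>q\<^sub>m(w m) \<rightarrow> 0\<close>. Indeed, if \<open>l \<le> 0\<close> is such that \<open>Y - z\<close> is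
  centred under the tilting by \<open>exp (l (Y - z))\<close>, then \<open>exp (- l x) (R - x\<^sup>2)\<close> gives a growing
  subsolution of the recursion for \<open>1 - q\<^sub>m\<close> over a block of generations, which keeps \<open>1 - q\<^sub>m(w m)\<close> away
  from \<open>0\<close>; the power \<open>k\<close> in the recursion then improves \<open>q\<^sub>m(w m) \<le> r < 1\<close> to convergence to \<open>0\<close>.
  Finally, with \<open>K = E exp (b Y)\<close>, \<open>b < \<alpha>\<close>, the bounds \<open>q\<^sub>m(y) \<le> (D exp (- b y))\<^sup>k\<close> and
  \<open>q\<^sub>m(t) \<le> \<theta>\<^sup>k\<close> imply \<open>q\<^sub>m(y) \<le> (exp (b t) + \<theta> D) exp (- b y)\<close> and hence
  \<open>q\<^sub>m\<^sub>+\<^sub>1(x) \<le> (K (exp (b t) + \<theta> D) exp (- b x))\<^sup>k\<close>. With \<open>t = w m\<close> and \<open>K \<theta>\<close> small the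
  constant \<open>D\<close> grows only like \<open>exp (b w m)\<close>.
\<close>

subsection \<open>Reduction to a recursion on the line\<close>

text \<open>The label of the root is left out, so that the first generation splits the minimum into
  \<open>k\<close> separate subtrees.\<close>

fun tree_min :: "nat \<Rightarrow> nat \<Rightarrow> (nat list \<Rightarrow> real) \<Rightarrow> real" where
  "tree_min k 0 f = 0"
| "tree_min k (Suc m) f = Min ((\<lambda>i. f [i] + tree_min k m (\<lambda>u. f (i # u))) ` {1..k})"

lemma level_0: "level k 0 = {[]}"
  by (auto simp: level_def)

lemma level_Suc: "level k (Suc m) = (\<Union>i\<in>{1..k}. (#) i ` level k m)"
proof -
  have "u \<in> (\<Union>i\<in>{1..k}. (#) i ` level k m)" if "u \<in> level k (Suc m)" for u
    using that by (cases u) (auto simp: level_def)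
  then show ?thesis by (auto simp: level_def)
qed

lemma finite_level: "finite (level k m)"
  by (induction m) (auto simp: level_0 level_Suc)

lemma level_nonempty: "k \<ge> 1 \<Longrightarrow> level k m \<noteq> {}"
  by (induction m) (auto simp: level_0 level_Suc)

lemma words_iff: "u \<in> words k \<longleftrightarrow> set u \<subseteq> {1..k}"
  by (auto simp: words_def level_def)

lemma sum_prefix_Cons:
  fixes f :: "nat list \<Rightarrow> real"
  shows "(\<Sum>v | prefix v (i # u). f v) = f [] + (\<Sum>v | prefix v u. f (i # v))"
proof -
  have fin: "finite {v. prefix v u}"
    by (rule finite_subset[of _ "set (prefixes u)"]) auto
  have "{v. prefix v (i # u)} = insert [] ((#) i ` {v. prefix v u})"
    by (auto simp: prefix_Cons)
  then have "(\<Sum>v | prefix v (i # u). f v) = f [] + (\<Sum>v\<in>(#) i ` {v. prefix v u}. f v)"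
    using fin by (simp add: sum.insert image_iff)
  also have "(\<Sum>v\<in>(#) i ` {v. prefix v u}. f v) = (\<Sum>v | prefix v u. f (i # v))"
    by (subst sum.reindex) (auto simp: inj_on_def)
  finally show ?thesis .
qed

lemma Min_UN:
  fixes A :: "'i \<Rightarrow> 'c::linorder set"
  assumes "finite I" "I \<noteq> {}" "\<And>i. i \<in> I \<Longrightarrow> finite (A i)" "\<And>i. i \<in> I \<Longrightarrow> A i \<noteq> {}"
  shows "Min (\<Union>i\<in>I. A i) = Min ((\<lambda>i. Min (A i)) ` I)"
proof (rule Min_eqI)
  show "finite (\<Union>i\<in>I. A i)" using assms by auto
  show "Min ((\<lambda>i. Min (A i)) ` I) \<le> y" if "y \<in> (\<Union>i\<in>I. A i)" for y
  proof -
    from that obtain i where i: "i \<in> I" "y \<in> A i" by auto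
    have "Min ((\<lambda>i. Min (A i)) ` I) \<le> Min (A i)" using assms i by (intro Min_le) auto
    also have "\<dots> \<le> y" using assms i by (intro Min_le) auto
    finally show ?thesis .
  qed
  have "Min ((\<lambda>i. Min (A i)) ` I) \<in> (\<lambda>i. Min (A i)) ` I" using assms by (intro Min_in) auto
  then obtain i where i: "i \<in> I" "Min ((\<lambda>i. Min (A i)) ` I) = Min (A i)" by auto
  with Min_in[OF assms(3)[OF i(1)] assms(4)[OF i(1)]]
  show "Min ((\<lambda>i. Min (A i)) ` I) \<in> (\<Union>i\<in>I. A i)"
    by (simp only: UN_iff) blast
qed

text \<open>The root label is a separate summand because in the induction the root of a subtree
  carries the displacement of a child.\<close>

lemma Min_prefix_sums:
  fixes f :: "nat list \<Rightarrow> real"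
  assumes "k \<ge> 1"
  shows "Min ((\<lambda>u. \<Sum>v | prefix v u. f v) ` level k m) = f [] + tree_min k m f"
proof (induction m arbitrary: f)
  case 0
  then show ?case by (simp add: level_0)
next
  case (Suc m)
  have "(\<lambda>u. \<Sum>v | prefix v u. f v) ` level k (Suc m) =
      (\<Union>i\<in>{1..k}. (\<lambda>u. \<Sum>v | prefix v u. f v) ` (#) i ` level k m)"
    unfolding level_Suc by blast
  also have "\<dots> = (\<Union>i\<in>{1..k}. (\<lambda>s. s + f []) ` (\<lambda>u. \<Sum>v | prefix v u. f (i # v)) ` level k m)"
    by (simp add: image_image sum_prefix_Cons add.commute)
  also have "Min \<dots> = Min ((\<lambda>i. Min ((\<lambda>s. s + f []) ` (\<lambda>u. \<Sum>v | prefix v u. f (i # v)) ` level k m)) ` {1..k})"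
    using assms by (intro Min_UN) (auto simp: finite_level level_nonempty)
  also have "\<dots> = Min ((\<lambda>i. f [i] + tree_min k m (\<lambda>u. f (i # u)) + f []) ` {1..k})"
  proof (rule arg_cong[where f = Min], rule image_cong[OF refl])
    fix i
    have "Min ((\<lambda>s. s + f []) ` (\<lambda>u. \<Sum>v | prefix v u. f (i # v)) ` level k m) =
        Min ((\<lambda>u. \<Sum>v | prefix v u. f (i # v)) ` level k m) + f []"
      using Min_add_commute[of "level k m" "\<lambda>u. \<Sum>v | prefix v u. f (i # v)" "f []"]
      assms by (simp add: finite_level level_nonempty image_image)
    also have "Min ((\<lambda>u. \<Sum>v | prefix v u. f (i # v)) ` level k m) = f [i] + tree_min k m (\<lambda>u. f (i # u))"
      by (rule Suc.IH)
    finally show "Min ((\<lambda>s. s + f []) ` (\<lambda>u. \<Sum>v | prefix v u. f (i # v)) ` level k m) =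
      f [i] + tree_min k m (\<lambda>u. f (i # u)) + f []" .
  qed
  also have "\<dots> = f [] + tree_min k (Suc m) f"
    using assms by (subst Min_add_commute) auto
  finally show ?case .
qed

text \<open>Lets a family be replaced by its restriction to the labels of a subtree, the form in
  which independence of blocks is expressed.\<close>

lemma tree_min_cong:
  assumes "\<And>u. u \<in> words k - {[]} \<Longrightarrow> f u = g u"
  shows "tree_min k m f = tree_min k m g"
  using assms
proof (induction m arbitrary: f g)
  case (Suc m)
  have "tree_min k m (\<lambda>u. f (i # u)) = tree_min k m (\<lambda>u. g (i # u))" if "i \<in> {1..k}" for i
    using that by (intro Suc.IH Suc.prems) (auto simp: words_iff)
  moreover have "f [i] = g [i]" if "i \<in> {1..k}" for i
    using that by (intro Suc.prems) (auto simp: words_iff)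
  ultimately show ?case by (auto intro!: arg_cong[where f = Min] image_cong)
qed simp

lemma measurable_tree_min:
  assumes "\<And>u. u \<in> words k - {[]} \<Longrightarrow> (\<lambda>\<omega>. F \<omega> u) \<in> borel_measurable M"
  shows "(\<lambda>\<omega>. tree_min k m (F \<omega>)) \<in> borel_measurable M"
  using assms
proof (induction m arbitrary: F)
  case (Suc m)
  have "(\<lambda>\<omega>. F \<omega> [i] + tree_min k m (\<lambda>u. F \<omega> (i # u))) \<in> borel_measurable M" if "i \<in> {1..k}" for i
    using that by (intro borel_measurable_add Suc.IH Suc.prems) (auto simp: words_iff)
  then show ?case by (auto intro!: borel_measurable_Min)
qed simp

section \<open>The law of the minimum\<close>

fun tail :: "real measure \<Rightarrow> nat \<Rightarrow> nat \<Rightarrow> real \<Rightarrow> real" where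
  "tail \<mu> k 0 x = (if x \<le> 0 then 1 else 0)"
| "tail \<mu> k (Suc m) x = (\<integral>y. tail \<mu> k m (x - y) \<partial>\<mu>) ^ k"

text \<open>The induction runs over all subtrees at once, so that no reindexing of the family is needed.\<close>

lemma (in prob_space) prob_tree_min_ge:
  fixes X :: "nat list \<Rightarrow> 'a \<Rightarrow> real"
  assumes ind: "indep_vars (\<lambda>_. borel) X (words k - {[]})"
    and law: "\<And>u. u \<in> words k - {[]} \<Longrightarrow> distr M borel (X u) = \<mu>"
    and k: "k \<ge> 1" and w: "w \<in> words k"
  shows "prob {\<omega> \<in> space M. tree_min k m (\<lambda>u. X (w @ u) \<omega>) \<ge> x} = tail \<mu> k m x"
  using w
proof (induction m arbitrary: w x)
  case 0
  then show ?case by (simp add: prob_space)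
next
  case (Suc m)
  define W where "W = words k - {[]}"
  define Z where "Z = (\<lambda>i \<omega>. X (w @ [i]) \<omega> + tree_min k m (\<lambda>u. X (w @ i # u) \<omega>))"
  \<comment> \<open>The labels at and below child \<open>i\<close>. These blocks are disjoint, which
    makes the \<open>Z i\<close> independent.\<close>
  define K where "K = (\<lambda>i. (\<lambda>u. w @ i # u) ` words k)"
  have X [measurable]: "X u \<in> borel_measurable M" if "u \<in> W" for u
    using ind that by (auto simp: indep_vars_def W_def)
  have KW: "K i \<subseteq> W" if "i \<in> {1..k}" for i
    using that Suc.prems by (auto simp: K_def W_def words_iff)
  have disj: "disjoint_family_on K {1..k}"
    by (auto simp: disjoint_family_on_def K_def)
  have Zf: "Z i \<omega> = (\<lambda>f. f (w @ [i]) + tree_min k m (\<lambda>u. f (w @ i # u))) (restrict (\<lambda>v. X v \<omega>) (K i))"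
    for i \<omega>
  proof -
    have "tree_min k m (\<lambda>u. X (w @ i # u) \<omega>) = tree_min k m (\<lambda>u. restrict (\<lambda>v. X v \<omega>) (K i) (w @ i # u))"
      by (rule tree_min_cong) (auto simp: K_def)
    then show ?thesis by (auto simp: Z_def K_def words_iff image_iff)
  qed
  have meas: "(\<lambda>f. f (w @ [i]) + tree_min k m (\<lambda>u. f (w @ i # u))) \<in> borel_measurable (PiM (K i) (\<lambda>_. borel))" for i
    by (intro borel_measurable_add measurable_tree_min measurable_component_singleton)
       (auto simp: K_def words_iff image_iff)
  have indZ: "indep_vars (\<lambda>_. borel) Z {1..k}"
    using indep_vars_compose2[OF indep_vars_restrict[OF ind KW[unfolded W_def] disj] meas]
    unfolding Zf .
  have single: "prob {\<omega> \<in> space M. Z i \<omega> \<ge> x} = (\<integral>y. tail \<mu> k m (x - y) \<partial>\<mu>)" if i: "i \<in> {1..k}" for i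
  proof -
    define A where "A = X (w @ [i])"
    define B where "B = (\<lambda>\<omega>. tree_min k m (\<lambda>u. X (w @ i # u) \<omega>))"
    \<comment> \<open>The child itself is excluded, so that its step \<open>A\<close> and the
      subtree minimum \<open>B\<close> depend on disjoint sets of labels.\<close>
    define J where "J = (\<lambda>u. w @ i # u) ` (words k - {[]})"
    have wi: "w @ [i] \<in> words k" "w @ [i] \<in> words k - {[]}" using Suc.prems i by (auto simp: words_iff)
    have JW: "J \<subseteq> W" using Suc.prems i by (auto simp: J_def W_def words_iff)
    have Bf: "B \<omega> = (\<lambda>f. tree_min k m (\<lambda>u. f (w @ i # u))) (restrict (\<lambda>v. X v \<omega>) J)" for \<omega>
      unfolding B_def by (simp, rule tree_min_cong) (auto simp: J_def)
    have Bm: "(\<lambda>f. tree_min k m (\<lambda>u. f (w @ i # u))) \<in> borel_measurable (PiM J (\<lambda>_. borel))"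
      by (intro measurable_tree_min measurable_component_singleton) (auto simp: J_def)
    have "indep_var (PiM {w @ [i]} (\<lambda>_. borel)) (\<lambda>\<omega>. restrict (\<lambda>v. X v \<omega>) {w @ [i]})
        (PiM J (\<lambda>_. borel)) (\<lambda>\<omega>. restrict (\<lambda>v. X v \<omega>) J)"
      using wi JW unfolding W_def by (intro indep_var_restrict[OF ind]) (auto simp: J_def)
    from indep_var_compose[OF this _ Bm, of "\<lambda>f. f (w @ [i])" borel]
    have indAB: "indep_var borel A borel B"
      unfolding A_def o_def Bf[symmetric] by (auto simp: measurable_component_singleton comp_def Bf[symmetric])
    have AM [measurable]: "A \<in> borel_measurable M" and BM [measurable]: "B \<in> borel_measurable M"
      using indep_var_rv1[OF indAB] indep_var_rv2[OF indAB] by auto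
    have dA: "distr M borel A = \<mu>" unfolding A_def using wi by (intro law)
    interpret B: prob_space "distr M borel B" by (rule prob_space_distr) simp
    define S where "S = {p::real\<times>real. fst p + snd p \<ge> x}"
    have S [measurable]: "S \<in> sets (borel \<Otimes>\<^sub>M borel)" 
      unfolding S_def borel_prod by (intro borel_closed closed_Collect_le continuous_intros)
    have S' : "S \<in> sets (distr M borel A \<Otimes>\<^sub>M distr M borel B)" using S by (simp cong: sets_pair_measure_cong)
    have ev: "{\<omega> \<in> space M. Z i \<omega> \<ge> x} = (\<lambda>\<omega>. (A \<omega>, B \<omega>)) -` S \<inter> space M"
      by (auto simp: S_def Z_def A_def B_def)
    have "emeasure M {\<omega> \<in> space M. Z i \<omega> \<ge> x} = emeasure (distr M (borel \<Otimes>\<^sub>M borel) (\<lambda>\<omega>. (A \<omega>, B \<omega>))) S"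
      using S by (simp add: emeasure_distr ev)
    also have "\<dots> = emeasure (distr M borel A \<Otimes>\<^sub>M distr M borel B) S"
      using indAB by (simp add: indep_var_distribution_eq)
    also have "\<dots> = (\<integral>\<^sup>+ y. emeasure (distr M borel B) (Pair y -` S) \<partial>distr M borel A)"
      using S' by (rule B.emeasure_pair_measure_alt)
    also have "\<dots> = (\<integral>\<^sup>+ y. ennreal (tail \<mu> k m (x - y)) \<partial>distr M borel A)"
    proof (rule nn_integral_cong)
      fix y
      have "emeasure (distr M borel B) (Pair y -` S) = emeasure M {\<omega> \<in> space M. B \<omega> \<ge> x - y}"
        by (subst emeasure_distr) (auto simp: S_def algebra_simps intro!: arg_cong2[where f = emeasure])
      also have "\<dots> = ennreal (prob {\<omega> \<in> space M. tree_min k m (\<lambda>u. X ((w @ [i]) @ u) \<omega>) \<ge> x - y})"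
        by (simp add: B_def emeasure_eq_measure)
      also have "\<dots> = ennreal (tail \<mu> k m (x - y))" using Suc.IH[OF wi(1)] by simp
      finally show "emeasure (distr M borel B) (Pair y -` S) = ennreal (tail \<mu> k m (x - y))" .
    qed
    finally have eq: "emeasure M {\<omega> \<in> space M. Z i \<omega> \<ge> x} = (\<integral>\<^sup>+ y. ennreal (tail \<mu> k m (x - y)) \<partial>\<mu>)"
      by (simp add: dA)
    \<comment> \<open>As the probability of reaching a level, \<open>tail\<close> is bounded and
      monotone, hence measurable; this turns the nonnegative integral into the Bochner integral of
      the recursion.\<close>
    have tail_eq: "tail \<mu> k m t = prob {\<omega> \<in> space M. t \<le> B \<omega>}" for t
      using Suc.IH[OF wi(1), of t] by (simp add: B_def)
    have "antimono (tail \<mu> k m)"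
      unfolding tail_eq by (intro antimonoI finite_measure_mono) auto
    then have "mono (\<lambda>t. - tail \<mu> k m t)" by (auto simp: mono_def antimono_def)
    then have tm: "tail \<mu> k m \<in> borel_measurable borel"
      using borel_measurable_mono[of "\<lambda>t. - tail \<mu> k m t"] borel_measurable_uminus_eq by fastforce
    have sets: "sets \<mu> = sets borel" using dA by auto
    have "(\<lambda>y. tail \<mu> k m (x - y)) \<in> borel_measurable \<mu>"
      using tm by (auto simp: measurable_cong_sets[OF sets refl])
    then have "integral\<^sup>L \<mu> (\<lambda>y. tail \<mu> k m (x - y)) = enn2real (\<integral>\<^sup>+ y. ennreal (tail \<mu> k m (x - y)) \<partial>\<mu>)"
      by (intro integral_eq_nn_integral) (auto simp: tail_eq)
    then show ?thesis by (simp add: eq[symmetric] measure_def)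
  qed
  have "{\<omega> \<in> space M. tree_min k (Suc m) (\<lambda>u. X (w @ u) \<omega>) \<ge> x} =
      (\<Inter>i\<in>{1..k}. Z i -` {x..} \<inter> space M)"
    using k by (auto simp: Z_def)
  also have "prob \<dots> = (\<Prod>i\<in>{1..k}. prob (Z i -` {x..} \<inter> space M))"
    using k by (intro indep_varsD_finite[OF indZ]) auto
  also have "\<dots> = (\<Prod>i\<in>{1..k}. \<integral>y. tail \<mu> k m (x - y) \<partial>\<mu>)"
    by (intro prod.cong refl) (auto simp: single[symmetric] intro!: arg_cong[where f = prob])
  finally show ?case by simp
qed

lemma prob_min_position_ge:
  assumes "branching_random_walk k N Y P X" "k \<ge> 1"
  shows "measure P {\<omega> \<in> space P. min_position k X m \<omega> \<ge> x} = tail (distr N borel Y) k m x"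
proof -
  interpret prob_space P using assms by (simp add: branching_random_walk_def)
  have "min_position k X m \<omega> = tree_min k m (\<lambda>u. X ([] @ u) \<omega>)" if "\<omega> \<in> space P" for \<omega>
    using assms that Min_prefix_sums[of k "\<lambda>v. X v \<omega>" m]
    by (simp add: min_position_def position_def branching_random_walk_def)
  then have "{\<omega> \<in> space P. min_position k X m \<omega> \<ge> x} = {\<omega> \<in> space P. tree_min k m (\<lambda>u. X ([] @ u) \<omega>) \<ge> x}"
    by auto
  also have "prob \<dots> = tail (distr N borel Y) k m x"
    using assms by (intro prob_tree_min_ge) (auto simp: branching_random_walk_def words_iff)
  finally show ?thesis .
qed

subsection \<open>The recursion under an exponential tail\<close>

text \<open>The analysis depends on the law of the step only, so the step variable becomes the
  identity on the line.\<close>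

locale exponential_steps = real_distribution \<mu> for \<mu> :: "real measure" +
  fixes k :: nat and \<alpha> :: real
  assumes k2: "k \<ge> 2"
    and nonneg: "AE y in \<mu>. 0 \<le> y"
    and \<alpha>_pos: "\<alpha> > 0"
    and exp_tail: "exponential_tail \<mu> (\<lambda>y. y) \<alpha>"
begin

abbreviation q :: "nat \<Rightarrow> real \<Rightarrow> real" where "q \<equiv> tail \<mu> k"

lemma prob_UNIV [simp]: "prob UNIV = 1"
  using prob_space by simp

lemma integrable_indicator_atLeast: "integrable \<mu> (indicator {x..} :: real \<Rightarrow> real)"
  by (intro integrable_const_bound[of _ 1]) auto

text \<open>One induction serves both claims: monotonicity of \<open>q m\<close> yields
  measurability, and boundedness then integrability, of the next integrand.\<close>

lemma tail_basic: "(\<forall>x. 0 \<le> q m x \<and> q m x \<le> 1) \<and> antimono (q m)"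
proof (induction m)
  case 0
  show ?case by (auto simp: antimono_def)
next
  case (Suc m)
  have "mono (\<lambda>t. - q m t)" using Suc by (auto simp: mono_def antimono_def)
  from borel_measurable_mono[OF this] have m [measurable]: "q m \<in> borel_measurable borel"
    using borel_measurable_uminus_eq by fastforce
  have i: "integrable \<mu> (\<lambda>y. q m (x - y))" for x
    using Suc by (intro integrable_const_bound[of _ 1]) auto
  have "0 \<le> (\<integral>y. q m (x - y) \<partial>\<mu>)" "(\<integral>y. q m (x - y) \<partial>\<mu>) \<le> 1" for x
    using Suc i by (auto intro!: integral_nonneg_AE integral_le_const)
  moreover have "(\<integral>y. q m (x' - y) \<partial>\<mu>) \<le> (\<integral>y. q m (x - y) \<partial>\<mu>)" if "x \<le> x'" for x x'
    using Suc that i by (intro integral_mono) (auto simp: antimono_def)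
  ultimately show ?case by (auto simp: antimono_def power_le_one power_mono)
qed

lemma tail_nonneg: "0 \<le> q m x" and tail_le_1: "q m x \<le> 1"
  using tail_basic by auto

lemma tail_antimono: "x \<le> y \<Longrightarrow> q m y \<le> q m x"
  using tail_basic by (auto simp: antimono_def)

lemma measurable_tail [measurable]: "q m \<in> borel_measurable borel"
proof -
  have "mono (\<lambda>t. - q m t)" using tail_antimono by (auto simp: mono_def)
  from borel_measurable_mono[OF this] show ?thesis
    using borel_measurable_uminus_eq by fastforce
qed

lemma integrable_tail: "integrable \<mu> (\<lambda>y. q m (x - y))"
  using tail_nonneg tail_le_1 by (intro integrable_const_bound[of _ 1]) auto

lemma integral_tail: "0 \<le> (\<integral>y. q m (x - y) \<partial>\<mu>)" "(\<integral>y. q m (x - y) \<partial>\<mu>) \<le> 1"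
  using tail_nonneg tail_le_1 integrable_tail by (auto intro!: integral_nonneg_AE integral_le_const)

section \<open>Tail bounds and moments\<close>

lemma eventually_tail_probability:
  assumes "c > 0"
  shows "\<forall>\<^sub>F x in at_top. exp (- (\<alpha> + c) * x) \<le> prob {x..} \<and> prob {x..} \<le> exp (- (\<alpha> - c) * x)"
proof -
  \<comment> \<open>Keeping \<open>d\<close> below \<alpha> rules out vanishing probabilities: with
    \<open>ln 0 = 0\<close> they would give \<open>\<alpha> * x \<le> d * x\<close>.\<close>
  define d where "d = min c (\<alpha> / 2)"
  have d: "d > 0" "d \<le> c" "d < \<alpha>" using assms \<alpha>_pos by (auto simp: d_def)
  have "\<forall>\<^sub>F x in at_top. norm (ln (prob {x..}) - (- \<alpha> * x)) \<le> d * norm x"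
    using landau_o.smallD[OF exp_tail[unfolded exponential_tail_def] d(1)]
    by (simp add: atLeast_def)
  then show ?thesis using eventually_gt_at_top[of 0]
  proof eventually_elim
    case (elim x)
    have "prob {x..} \<noteq> 0"
    proof
      assume "prob {x..} = 0"
      then have "\<alpha> * x \<le> d * x" using elim \<alpha>_pos by (simp add: abs_mult)
      then show False using d elim by simp
    qed
    then have p: "prob {x..} > 0" by (simp add: less_le)
    have dc: "d * x \<le> c * x" using d elim by simp
    have e: "\<bar>ln (prob {x..}) + \<alpha> * x\<bar> \<le> d * x" using elim by simp
    have "- (\<alpha> + c) * x \<le> ln (prob {x..})" "ln (prob {x..}) \<le> - (\<alpha> - c) * x"
      using abs_le_D1[OF e] abs_le_D2[OF e] dc by (simp_all add: distrib_right left_diff_distrib del: mult_le_cancel_right_pos)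
    then have "exp (- (\<alpha> + c) * x) \<le> exp (ln (prob {x..}))" "exp (ln (prob {x..})) \<le> exp (- (\<alpha> - c) * x)"
      by (simp_all only: exp_le_cancel_iff)
    then show ?case using p by simp
  qed
qed

lemma integrable_exp_neg: "l \<le> 0 \<Longrightarrow> integrable \<mu> (\<lambda>y. exp (l * y))"
  using nonneg by (intro integrable_const_bound[of _ 1]) (auto simp: mult_nonpos_nonneg)

text \<open>On a unit slice \<open>exp (b * y)\<close> is at most \<open>exp (b * (n + 1))\<close>,
  and for \<open>b < a < \<alpha>\<close> the tail at \<open>n\<close> is eventually below
  \<open>exp (- a * n)\<close>; the sum over slices is dominated by a geometric series.\<close>

lemma integrable_exp:
  assumes b: "0 < b" "b < \<alpha>"
  shows "integrable \<mu> (\<lambda>y. exp (b * y))"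
proof -
  define a where "a = (b + \<alpha>) / 2"
  have a: "b < a" "a < \<alpha>" using b by (auto simp: a_def)
  define f where "f = (\<lambda>n. exp (b * (real n + 1)) * prob {real n..})"
  have "\<forall>\<^sub>F x in at_top. prob {x..} \<le> exp (- a * x)"
    using eventually_tail_probability[of "\<alpha> - a"] a by (auto elim: eventually_mono)
  then have ev: "\<forall>\<^sub>F n in sequentially. prob {real n..} \<le> exp (- a * real n)"
    using filterlim_real_sequentially by (auto simp: filterlim_iff)
  have "summable (\<lambda>n. exp b * exp (b - a) ^ n)"
    using a by (intro summable_mult summable_geometric) auto
  moreover have "\<forall>\<^sub>F n in sequentially. norm (f n) \<le> exp b * exp (b - a) ^ n"
    using ev
  proof eventually_elim
    case (elim n)
    have "f n \<le> exp (b * (real n + 1)) * exp (- a * real n)"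
      unfolding f_def using elim by (intro mult_left_mono) auto
    also have "\<dots> = exp b * exp (b - a) ^ n"
      by (simp add: exp_of_nat_mult[symmetric] exp_add[symmetric] algebra_simps)
    finally show ?case by (simp add: f_def)
  qed
  ultimately have sf: "summable f" by (rule summable_comparison_test_ev[rotated])
  have "(\<integral>\<^sup>+ y. ennreal (exp (b * y)) \<partial>\<mu>) \<le>
      (\<integral>\<^sup>+ y. (\<Sum>n. ennreal (exp (b * (real n + 1))) * indicator {real n..} y) \<partial>\<mu>)"
  proof (rule nn_integral_mono_AE)
    show "AE y in \<mu>. ennreal (exp (b * y)) \<le> (\<Sum>n. ennreal (exp (b * (real n + 1))) * indicator {real n..} y)"
      using nonneg
    proof eventually_elim
      case (elim y)
      define n where "n = nat \<lfloor>y\<rfloor>"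
      have n: "real n \<le> y" "y \<le> real n + 1" using elim by (auto simp: n_def)
      have single: "g n \<le> suminf g" for g :: "nat \<Rightarrow> ennreal"
        using sum_le_suminf[OF summableI, of "{n}" g] by simp
      have "ennreal (exp (b * y)) \<le> ennreal (exp (b * (real n + 1))) * indicator {real n..} y"
        using n b by (auto intro!: ennreal_leI)
      also have "\<dots> \<le> (\<Sum>n. ennreal (exp (b * (real n + 1))) * indicator {real n..} y)"
        by (rule single)
      finally show ?case .
    qed
  qed
  also have "\<dots> = (\<Sum>n. \<integral>\<^sup>+ y. ennreal (exp (b * (real n + 1))) * indicator {real n..} y \<partial>\<mu>)"
    by (intro nn_integral_suminf) auto
  also have "\<dots> = (\<Sum>n. ennreal (f n))"
    by (intro suminf_cong) (subst nn_integral_cmult_indicator, simp, simp only: f_def emeasure_eq_measure ennreal_mult' exp_ge_zero)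
  also have "\<dots> < \<infinity>"
    by (subst suminf_ennreal2[OF _ sf]) (auto simp: f_def)
  finally show ?thesis by (intro integrableI_bounded) auto
qed

lemma integrable_id: "integrable \<mu> (\<lambda>y. y)"
  and integrable_square: "integrable \<mu> (\<lambda>y. y\<^sup>2)"
proof -
  define b where "b = \<alpha> / 2"
  have b: "0 < b" "b < \<alpha>" using \<alpha>_pos by (auto simp: b_def)
  have "integrable \<mu> (\<lambda>y. 2 / b\<^sup>2 * exp (b * y))"
    using integrable_exp[OF b] by simp
  then show s: "integrable \<mu> (\<lambda>y. y\<^sup>2)"
  proof (rule Bochner_Integration.integrable_bound)
    show "AE y in \<mu>. norm (y\<^sup>2) \<le> norm (2 / b\<^sup>2 * exp (b * y))"
      using nonneg
    proof eventually_elim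
      case (elim y)
      have "1 + b * y + (b * y)\<^sup>2 / 2 \<le> exp (b * y)"
        using elim b by (intro exp_lower_Taylor_quadratic) auto
      then have "(b * y)\<^sup>2 / 2 \<le> exp (b * y)" using mult_nonneg_nonneg[of b y] elim b by linarith
      then show ?case using b by (simp add: field_simps power_mult_distrib)
    qed
  qed auto
  have "integrable \<mu> (\<lambda>y. 1 + y\<^sup>2)" using s by auto
  then show "integrable \<mu> (\<lambda>y. y)"
  proof (rule Bochner_Integration.integrable_bound)
    have "\<bar>y\<bar> \<le> 1 + y\<^sup>2" for y :: real
      using zero_le_power2[of "\<bar>y\<bar> - 1"] by (simp add: power2_diff)
    then show "AE y in \<mu>. norm y \<le> norm (1 + y\<^sup>2)"
      by (auto simp: abs_of_nonneg)
  qed auto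
qed

text \<open>For nonnegative steps and \<open>l \<le> 0\<close> the tilting factor is at most
  \<open>exp (- l * z)\<close>, which leaves polynomial moments only.\<close>

lemma integrable_exp_centred:
  assumes "l \<le> 0"
  shows "integrable \<mu> (\<lambda>y. exp (l * (y - z)))"
    "integrable \<mu> (\<lambda>y. (y - z) * exp (l * (y - z)))"
    "integrable \<mu> (\<lambda>y. (y - z)\<^sup>2 * exp (l * (y - z)))"
proof -
  have b: "AE y in \<mu>. exp (l * (y - z)) \<le> exp (- l * z)"
    using nonneg by eventually_elim (use assms in \<open>auto simp: algebra_simps mult_nonneg_nonpos\<close>)
  show "integrable \<mu> (\<lambda>y. exp (l * (y - z)))"
    using b by (intro integrable_const_bound[of _ "exp (- l * z)"]) auto
  have "integrable \<mu> (\<lambda>y. (y - z) * exp (- l * z))" using integrable_id by auto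
  then show "integrable \<mu> (\<lambda>y. (y - z) * exp (l * (y - z)))"
    by (rule Bochner_Integration.integrable_bound)
       (use b in \<open>auto simp: abs_mult elim!: eventually_mono intro!: mult_left_mono\<close>)
  have "integrable \<mu> (\<lambda>y. (y - z)\<^sup>2 * exp (- l * z))"
    using integrable_id integrable_square by (auto simp: power2_diff)
  then show "integrable \<mu> (\<lambda>y. (y - z)\<^sup>2 * exp (l * (y - z)))"
    by (rule Bochner_Integration.integrable_bound)
       (use b in \<open>auto simp: abs_mult elim!: eventually_mono intro!: mult_left_mono\<close>)
qed

section \<open>Inequalities for one generation and their iteration\<close>

lemma tail_lower_deviation:
  assumes l: "l \<le> 0"
  shows "1 - q m x \<le> exp (- l * x) * (k * (\<integral>y. exp (l * y) \<partial>\<mu>)) ^ m"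
proof (induction m arbitrary: x)
  case 0
  then show ?case using l by (auto simp: mult_nonpos_nonneg zero_le_mult_iff)
next
  case (Suc m)
  define E where "E = (\<integral>y. exp (l * y) \<partial>\<mu>)"
  define s where "s = (\<integral>y. q m (x - y) \<partial>\<mu>)"
  \<comment> \<open>Bernoulli's inequality acts as the union bound over the \<open>k\<close>
    children; its iteration is the first moment bound.\<close>
  have "1 - q (Suc m) x \<le> k * (1 - s)"
    using Bernoulli_inequality[of "s - 1" k] integral_tail[of m x] by (simp add: s_def algebra_simps)
  also have "1 - s = (\<integral>y. 1 - q m (x - y) \<partial>\<mu>)"
    unfolding s_def using integrable_tail by (simp add: prob_space)
  also have "\<dots> \<le> (\<integral>y. exp (- l * x) * (k * E) ^ m * exp (l * y) \<partial>\<mu>)"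
  proof (intro integral_mono)
    show "1 - q m (x - y) \<le> exp (- l * x) * (k * E) ^ m * exp (l * y)" for y
      using Suc[of "x - y"] by (simp add: E_def algebra_simps exp_diff exp_minus exp_add field_simps)
  qed (use integrable_tail integrable_exp_neg[OF l] in auto)
  also have "\<dots> = exp (- l * x) * (k * E) ^ m * E" by (simp add: E_def)
  finally have "1 - q (Suc m) x \<le> k * (exp (- l * x) * (k * E) ^ m * E)"
    by (simp add: mult_left_mono)
  then show ?case unfolding E_def[symmetric] by (simp add: mult_ac)
qed

text \<open>It suffices that all \<open>k\<close> children are displaced by at least
  \<open>x\<close> and all their subtrees have minimum at least \<open>y\<close>.\<close>

lemma tail_Suc_ge: "(prob {x..} * q m y) ^ k \<le> q (Suc m) (x + y)"
proof -
  have "prob {x..} * q m y = (\<integral>t. indicator {x..} t * q m y \<partial>\<mu>)"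
    by simp
  also have "\<dots> \<le> (\<integral>t. q m (x + y - t) \<partial>\<mu>)"
  proof (intro integral_mono)
    show "indicator {x..} t * q m y \<le> q m (x + y - t)" for t
      using tail_nonneg[of m "x + y - t"] tail_antimono[of "x + y - t" y m] by (cases "x \<le> t") auto
    show "integrable \<mu> (\<lambda>t. indicator {x..} t * q m y)"
      by (intro integrable_mult_left integrable_indicator_atLeast)
  qed (rule integrable_tail)
  finally show ?thesis by (auto intro!: power_mono mult_nonneg_nonneg tail_nonneg)
qed

text \<open>For each child, either its step reaches \<open>b\<close> or the minimum of its subtree
  has to exceed \<open>x\<close>.\<close>

lemma tail_Suc_le: "q (Suc m) (x + b) \<le> (q m x + prob {b..}) ^ k"
proof -
  have "(\<integral>t. q m (x + b - t) \<partial>\<mu>) \<le> (\<integral>t. q m x + indicator {b..} t \<partial>\<mu>)"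
  proof (intro integral_mono)
    show "q m (x + b - t) \<le> q m x + indicator {b..} t" for t
      using tail_antimono[of x "x + b - t" m] tail_le_1[of m "x + b - t"] tail_nonneg[of m x]
      by (cases "t < b") auto
  qed (use integrable_tail integrable_indicator_atLeast in auto)
  also have "\<dots> = q m x + prob {b..}"
    using integrable_indicator_atLeast by simp
  finally show ?thesis using integral_tail by (auto intro!: power_mono)
qed

text \<open>While \<open>exp (b * y)\<close> is integrable, its \<open>k\<close>-th power may fail
  to be. So a single power of \<open>exp (- b * y)\<close> is carried through the integral, and the
  recursion itself restores the power \<open>k\<close>.\<close>

lemma tail_Suc_exp_bound:
  assumes b: "b > 0" "integrable \<mu> (\<lambda>y. exp (b * y))"
    and D: "D \<ge> 0" "\<And>y. q m y \<le> (D * exp (- b * y)) ^ k"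
    and \<theta>: "0 \<le> \<theta>" "\<theta> \<le> 1" "q m t \<le> \<theta> ^ k"
  shows "q (Suc m) x \<le> ((\<integral>y. exp (b * y) \<partial>\<mu>) * (exp (b * t) + \<theta> * D) * exp (- b * x)) ^ k"
proof -
  have pt: "q m y \<le> (exp (b * t) + \<theta> * D) * exp (- b * y)" for y
  proof (cases "y < t")
    case True
    have "q m y \<le> 1" by (rule tail_le_1)
    also have "1 \<le> exp (b * t) * exp (- b * y)" using b True by (simp add: exp_add[symmetric])
    also have "\<dots> \<le> (exp (b * t) + \<theta> * D) * exp (- b * y)" using D \<theta> by (intro mult_right_mono) auto
    finally show ?thesis .
  next
    case False
    \<comment> \<open>Both \<open>u ^ k\<close> and \<open>\<theta> ^ k\<close> bound
      \<open>q m y\<close>. The smaller one is at most \<open>(min u \<theta>)\<^sup>2\<close>,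
      hence at most \<open>\<theta> * u\<close>: one of two factors is traded for the small
      \<theta>.\<close>
    define u where "u = D * exp (- b * y)"
    have u: "u \<ge> 0" using D by (simp add: u_def)
    have "q m y \<le> \<theta> * u"
    proof (cases "u \<le> \<theta>")
      case True
      have "q m y \<le> u ^ k" using D by (simp add: u_def)
      also have "\<dots> \<le> u ^ 2" using True \<theta> u k2 by (intro power_decreasing) auto
      also have "\<dots> \<le> \<theta> * u" using True u by (simp add: power2_eq_square mult_right_mono)
      finally show ?thesis .
    next
      case u\<theta>: False
      have "q m y \<le> q m t" using False by (intro tail_antimono) auto
      also have "\<dots> \<le> \<theta> ^ k" by fact
      also have "\<dots> \<le> \<theta> ^ 2" using \<theta> k2 by (intro power_decreasing) auto
      also have "\<dots> \<le> \<theta> * u" using u\<theta> \<theta> by (simp add: power2_eq_square mult_left_mono)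
      finally show ?thesis .
    qed
    also have "\<dots> \<le> (exp (b * t) + \<theta> * D) * exp (- b * y)" by (simp add: u_def algebra_simps)
    finally show ?thesis .
  qed
  have "(\<integral>y. q m (x - y) \<partial>\<mu>) \<le> (\<integral>y. ((exp (b * t) + \<theta> * D) * exp (- b * x)) * exp (b * y) \<partial>\<mu>)"
  proof (intro integral_mono)
    show "q m (x - y) \<le> ((exp (b * t) + \<theta> * D) * exp (- b * x)) * exp (b * y)" for y
      using pt[of "x - y"] by (simp add: algebra_simps exp_add[symmetric])
  qed (use integrable_tail b in auto)
  also have "\<dots> = (\<integral>y. exp (b * y) \<partial>\<mu>) * (exp (b * t) + \<theta> * D) * exp (- b * x)"
    by (simp add: mult_ac)
  finally show ?thesis using integral_tail by (auto intro!: power_mono)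
qed

text \<open>Supplies the initial constant at a fixed generation; its growth in \<open>m\<close> is
  left uncontrolled.\<close>

lemma tail_exp_bound_ex:
  assumes b: "b > 0" "integrable \<mu> (\<lambda>y. exp (b * y))"
  shows "\<exists>D\<ge>0. \<forall>x. q m x \<le> (D * exp (- b * x)) ^ k"
proof (induction m)
  case 0
  have "q 0 x \<le> (1 * exp (- b * x)) ^ k" for x
    using b by (auto intro!: one_le_power simp: mult_nonneg_nonpos)
  then show ?case by (intro exI[of _ 1]) auto
next
  case (Suc m)
  then obtain D where D: "D \<ge> 0" "\<And>y. q m y \<le> (D * exp (- b * y)) ^ k" by blast
  \<comment> \<open>With \<open>\<theta> = 1\<close> and \<open>t = 0\<close> the condition on
    \<open>q m t\<close> is trivial.\<close>
  show ?case
    using tail_Suc_exp_bound[OF b D, of 1 0] tail_le_1[of m 0] D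
    by (intro exI[of _ "(\<integral>y. exp (b * y) \<partial>\<mu>) * (exp (b * 0) + 1 * D)"]) auto
qed

lemma tail_exp_bound:
  assumes b: "b > 0" "integrable \<mu> (\<lambda>y. exp (b * y))"
    and lim: "\<And>r. r > 0 \<Longrightarrow> \<forall>\<^sub>F m in sequentially. q m (w * real m) \<le> r"
  shows "\<exists>C>0. \<forall>\<^sub>F m in sequentially. \<forall>x. q m x \<le> (C * exp (b * (w * real m - x))) ^ k"
proof -
  define K where "K = (\<integral>y. exp (b * y) \<partial>\<mu>)"
  have K: "K \<ge> 0" unfolding K_def by (intro integral_nonneg_AE) auto
  \<comment> \<open>A generation may enlarge the constant by the factor \<open>exp (b * w)\<close>;
    with this \<theta> the recurring term uses only half of it.\<close>
  define \<theta> where "\<theta> = min 1 (exp (b * w) / (2 * (K + 1)))"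
  have \<theta>: "\<theta> > 0" "\<theta> \<le> 1" using K by (auto simp: \<theta>_def)
  have K\<theta>: "K * \<theta> \<le> exp (b * w) / 2"
  proof -
    have "K * \<theta> \<le> (K + 1) * (exp (b * w) / (2 * (K + 1)))" using K \<theta> by (intro mult_mono) (auto simp: \<theta>_def)
    also have "\<dots> = exp (b * w) / 2"
    proof -
      have "L * (e / (2 * L)) = e / 2" if "L > 0" for L e :: real using that by simp
      then show ?thesis using K by (metis add_nonneg_pos zero_less_one)
    qed
    finally show ?thesis .
  qed
  obtain m0 where m0: "\<And>m. m \<ge> m0 \<Longrightarrow> q m (w * real m) \<le> \<theta> ^ k"
    using lim[of "\<theta> ^ k"] \<theta> by (auto simp: eventually_sequentially)
  obtain D where D: "D \<ge> 0" "\<And>x. q m0 x \<le> (D * exp (- b * x)) ^ k"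
    using tail_exp_bound_ex[OF b] by blast
  \<comment> \<open>The second summand covers the base case at \<open>m0\<close>; the third makes
    the fresh term \<open>K * exp (b * w * m)\<close> fit into the other half.\<close>
  define C where "C = 1 + D * exp (- b * w * m0) + 2 * K * exp (- b * w)"
  have C: "C > 0" "C \<ge> D * exp (- b * w * m0)" "C \<ge> 2 * K * exp (- b * w)"
    using D K by (auto simp: C_def add_pos_nonneg add_nonneg_nonneg)
  have "\<forall>x. q m x \<le> (C * exp (b * w * m) * exp (- b * x)) ^ k" if "m \<ge> m0" for m
    using that
  proof (induction m rule: dec_induct)
    case base
    have "D \<le> C * exp (b * w * m0)"
      using mult_right_mono[OF C(2), of "exp (b * w * m0)"] by (simp add: mult.assoc exp_add[symmetric])
    then have "(D * exp (- b * x)) ^ k \<le> (C * exp (b * w * m0) * exp (- b * x)) ^ k" for x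
      using D by (intro power_mono mult_right_mono) auto
    then show ?case using D order_trans by blast
  next
    case (step m)
    have IH: "\<And>x. q m x \<le> (C * exp (b * w * m) * exp (- b * x)) ^ k" using step.IH by blast
    have st: "q (Suc m) x \<le> (K * (exp (b * (w * m)) + \<theta> * (C * exp (b * w * m))) * exp (- b * x)) ^ k" for x
      unfolding K_def using IH C \<theta> m0[OF step.hyps(1)] by (intro tail_Suc_exp_bound[OF b]) auto
    have "2 * K \<le> C * exp (b * w)"
      using mult_right_mono[OF C(3), of "exp (b * w)"] by (simp add: mult.assoc exp_add[symmetric])
    moreover have "K * \<theta> * C \<le> exp (b * w) / 2 * C" using K\<theta> C by (intro mult_right_mono) auto
    ultimately have "K + K * \<theta> * C \<le> C * exp (b * w)" by (simp add: field_simps)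
    then have "(K + K * \<theta> * C) * exp (b * w * m) \<le> C * exp (b * w) * exp (b * w * m)"
      by (intro mult_right_mono) auto
    then have le: "K * (exp (b * (w * m)) + \<theta> * (C * exp (b * w * m))) \<le> C * exp (b * w * Suc m)"
      by (simp add: algebra_simps exp_add)
    have "(K * (exp (b * (w * m)) + \<theta> * (C * exp (b * w * m))) * exp (- b * x)) ^ k
        \<le> (C * exp (b * w * Suc m) * exp (- b * x)) ^ k" for x
      using le K C \<theta> by (intro power_mono mult_right_mono mult_nonneg_nonneg add_nonneg_nonneg) auto
    then show ?case using st order_trans by blast
  qed
  then have "\<forall>x. q m x \<le> (C * exp (b * (w * real m - x))) ^ k" if "m \<ge> m0" for m
    using that by (simp add: mult.assoc exp_add[symmetric] algebra_simps)
  then show ?thesis using C(1) by (auto simp: eventually_sequentially)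
qed

subsection \<open>The speed\<close>

definition mean :: real where "mean = (\<integral>y. y \<partial>\<mu>)"

text \<open>\<open>- ln (cmgf z l)\<close> is the expression under the supremum that defines the
  rate at \<open>z\<close>, so comparing the rate with \<open>ln k\<close> amounts to comparing
  \<open>k * cmgf z l\<close> with 1.\<close>

definition cmgf :: "real \<Rightarrow> real \<Rightarrow> real" where
  "cmgf z l = (\<integral>y. exp (l * (y - z)) \<partial>\<mu>)"

abbreviation rate :: "real \<Rightarrow> ereal" where "rate \<equiv> rate_function \<mu> (\<lambda>y. y)"

abbreviation \<gamma> :: real where "\<gamma> \<equiv> speed k \<mu> (\<lambda>y. y)"

lemma integrable_centred_iff:
  "integrable \<mu> (\<lambda>y. exp (l * (y - z))) \<longleftrightarrow> integrable \<mu> (\<lambda>y. exp (l * y))"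
proof -
  have "(\<lambda>y. exp (l * (y - z))) = (\<lambda>y. exp (l * y) * exp (- l * z))"
    by (simp add: fun_eq_iff exp_add[symmetric] algebra_simps)
  then show ?thesis by simp
qed

lemma cmgf_shift: "cmgf z l = exp (l * (z' - z)) * cmgf z' l"
proof -
  have "(\<lambda>y. exp (l * (y - z))) = (\<lambda>y. exp (l * (z' - z)) * exp (l * (y - z')))"
    by (simp add: fun_eq_iff exp_add[symmetric] algebra_simps)
  then show ?thesis by (simp add: cmgf_def)
qed

lemma cmgf_pos:
  assumes "integrable \<mu> (\<lambda>y. exp (l * y))"
  shows "cmgf z l > 0"
proof -
  have "\<not> (AE y in \<mu>. exp (l * (y - z)) = 0)" by simp
  then have "cmgf z l \<noteq> 0"
    unfolding cmgf_def using assms integrable_centred_iff[of l z]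
    by (subst integral_nonneg_eq_0_iff_AE) auto
  moreover have "cmgf z l \<ge> 0" unfolding cmgf_def by (intro integral_nonneg_AE) auto
  ultimately show ?thesis by simp
qed

text \<open>The tangent line of exp at 0. At the mean it is Jensen's inequality; below the mean it
  forces \<open>l < 0\<close> whenever \<open>cmgf z l < 1\<close>.\<close>

lemma cmgf_ge:
  assumes "integrable \<mu> (\<lambda>y. exp (l * y))"
  shows "cmgf z l \<ge> 1 + l * (mean - z)"
proof -
  have "1 + l * (mean - z) = (\<integral>y. 1 + l * (y - z) \<partial>\<mu>)"
    using integrable_id by (simp add: mean_def)
  also have "\<dots> \<le> cmgf z l"
    unfolding cmgf_def using integrable_id assms integrable_centred_iff[of l z]
    by (intro integral_mono) auto
  finally show ?thesis .
qed

lemma log_mgf_eq: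
  "log_mgf \<mu> (\<lambda>y. y) l = (if integrable \<mu> (\<lambda>y. exp (l * y)) then ereal (ln (cmgf 0 l)) else \<infinity>)"
proof (cases "integrable \<mu> (\<lambda>y. exp (l * y))")
  case True
  then have "(\<integral>\<^sup>+ y. ennreal (exp (l * y)) \<partial>\<mu>) = ennreal (cmgf 0 l)"
    by (simp add: nn_integral_eq_integral cmgf_def)
  then show ?thesis using True cmgf_pos[OF True, of 0] by (simp add: log_mgf_def)
next
  case False
  then have "(\<integral>\<^sup>+ y. ennreal (exp (l * y)) \<partial>\<mu>) = \<infinity>"
    by (auto simp: integrable_iff_bounded less_top[symmetric])
  then show ?thesis using False by (simp add: log_mgf_def)
qed

lemma ln_cmgf:
  assumes "integrable \<mu> (\<lambda>y. exp (l * y))"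
  shows "l * z - ln (cmgf 0 l) = - ln (cmgf z l)"
  using cmgf_pos[OF assms, of 0] by (simp add: cmgf_shift[of z l 0] ln_mult)

lemma rate_less_imp:
  assumes "rate z < ereal (ln (real k))" "integrable \<mu> (\<lambda>y. exp (l * y))"
  shows "k * cmgf z l > 1"
proof -
  have "ereal (l * z) - log_mgf \<mu> (\<lambda>y. y) l \<le> rate z"
    unfolding rate_function_def by (rule SUP_upper) simp
  then have "ereal (l * z - ln (cmgf 0 l)) \<le> rate z"
    using assms(2) by (simp add: log_mgf_eq)
  also note assms(1)
  finally have "ereal (l * z - ln (cmgf 0 l)) < ereal (ln (real k))" .
  then have "- ln (cmgf z l) < ln (real k)"
    using ln_cmgf[OF assms(2)] by simp
  then have "0 < ln (k * cmgf z l)"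
    using cmgf_pos[OF assms(2), of z] k2 by (simp add: ln_mult)
  then show ?thesis
    using cmgf_pos[OF assms(2), of z] k2 by (simp add: ln_gt_zero_iff)
qed

lemma less_rate_imp:
  assumes "ereal c < rate z"
  obtains l where "integrable \<mu> (\<lambda>y. exp (l * y))" "cmgf z l < exp (- c)"
proof -
  obtain l where l: "ereal c < ereal (l * z) - log_mgf \<mu> (\<lambda>y. y) l"
    using assms unfolding rate_function_def by (auto simp: less_SUP_iff)
  have i: "integrable \<mu> (\<lambda>y. exp (l * y))"
    using l by (cases "integrable \<mu> (\<lambda>y. exp (l * y))") (auto simp: log_mgf_eq)
  have "c < - ln (cmgf z l)" using l i ln_cmgf[OF i, of z] by (simp add: log_mgf_eq)
  then have "ln (cmgf z l) < - c" by simp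
  then have "cmgf z l < exp (- c)" using cmgf_pos[OF i] by (metis exp_less_mono exp_ln)
  with i show ?thesis by (rule that)
qed

definition subcritical :: "real set" where
  "subcritical = {z. z \<le> mean \<and> rate z < ereal (ln (real k))}"

lemma speed_eq: "\<gamma> = Inf subcritical"
  by (simp add: speed_def subcritical_def mean_def)

lemma ln_k_pos: "ln (real k) > 0"
  using k2 by simp

text \<open>Makes the set defining the speed nonempty: by Jensen's inequality no \<open>l\<close>
  brings \<open>cmgf mean l\<close> below 1.\<close>

lemma mean_subcritical: "mean \<in> subcritical"
proof -
  have "rate mean \<le> 0"
  proof (rule ccontr)
    assume "\<not> rate mean \<le> 0"
    then have "ereal 0 < rate mean" by (simp add: zero_ereal_def)
    then obtain l where "integrable \<mu> (\<lambda>y. exp (l * y))" "cmgf mean l < exp (- 0)"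
      by (rule less_rate_imp)
    then show False using cmgf_ge[of l mean] by simp
  qed
  also have "0 < ereal (ln (real k))" using ln_k_pos by simp
  finally show ?thesis by (simp add: subcritical_def)
qed

text \<open>Steps staying above \<open>z\<close> by a fixed amount would let a negative tilt push
  \<open>k * cmgf z l\<close> down to 1. With \<open>t = 0\<close> this bounds the set from below;
  later it provides mass below the centre of a tilt.\<close>

lemma not_AE_ge_of_subcritical:
  assumes "z \<in> subcritical" "z < t"
  shows "\<not> (AE y in \<mu>. t \<le> y)"
proof
  assume ae: "AE y in \<mu>. t \<le> y"
  \<comment> \<open>Solves \<open>exp (l * (t - z)) = 1 / k\<close>.\<close>
  define l where "l = - ln (real k) / (t - z)"
  have l: "l \<le> 0" using assms ln_k_pos by (simp add: l_def divide_nonpos_pos)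
  have "cmgf z l \<le> (\<integral>y. exp (l * (t - z)) \<partial>\<mu>)"
    unfolding cmgf_def
  proof (rule integral_mono_AE)
    show "AE y in \<mu>. exp (l * (y - z)) \<le> exp (l * (t - z))"
      using ae by eventually_elim (use l in \<open>auto intro: mult_left_mono_neg\<close>)
  qed (use integrable_exp_centred[OF l] in auto)
  also have "\<dots> = 1 / k" using assms k2 by (simp add: l_def exp_minus inverse_eq_divide)
  finally have "k * cmgf z l \<le> 1" using k2 by (simp add: field_simps)
  moreover have "k * cmgf z l > 1"
    using assms integrable_exp_neg[OF l] by (intro rate_less_imp) (auto simp: subcritical_def)
  ultimately show False by simp
qed

lemma subcritical_nonneg: "z \<in> subcritical \<Longrightarrow> 0 \<le> z"
  using not_AE_ge_of_subcritical[of z 0] nonneg by force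

lemma bdd_below_subcritical: "bdd_below subcritical"
  using subcritical_nonneg by (auto simp: bdd_below_def)

lemma speed_le_mean: "\<gamma> \<le> mean"
  unfolding speed_eq using mean_subcritical bdd_below_subcritical by (rule cInf_lower)

text \<open>At \<open>z1\<close> between \<open>z\<close> and the speed the rate is only known to be
  at least \<open>ln k\<close>, so a near-optimal \<open>l\<close> gives
  \<open>k * cmgf z1 l < exp \<kappa>\<close>. Passing from \<open>z1\<close> to \<open>z\<close>
  contributes \<open>exp (l * (z1 - z))\<close>, which absorbs this excess if \<open>l\<close> stays
  away from 0.\<close>

lemma chernoff_below_speed:
  assumes "z < \<gamma>"
  obtains l where "l \<le> 0" "k * cmgf z l < 1"
proof -
  define z1 where "z1 = (z + \<gamma>) / 2"
  have z1: "z < z1" "z1 < \<gamma>" using assms by (auto simp: z1_def)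
  have zm: "z1 < mean" using z1 speed_le_mean by simp
  have "z1 \<notin> subcritical" using z1 cInf_lower[OF _ bdd_below_subcritical, of z1] by (auto simp: speed_eq)
  then have rz: "rate z1 \<ge> ereal (ln (real k))" using zm by (auto simp: subcritical_def)
  \<comment> \<open>The cap \<open>\<kappa> \<le> ln k / 2\<close> keeps \<open>cmgf z1 l\<close>
    below \<open>e < 1\<close>, so the threshold \<open>l0\<close> for \<open>- l\<close> can be
    fixed before \<kappa>.\<close>
  define e where "e = exp (- (ln (real k) / 2))"
  have e: "0 < e" "e < 1" using ln_k_pos by (auto simp: e_def)
  define l0 where "l0 = (1 - e) / (mean - z1)"
  have l0: "l0 > 0" using e zm by (simp add: l0_def)
  define \<kappa> where "\<kappa> = min (ln (real k) / 2) (l0 * (z1 - z))"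
  have \<kappa>: "\<kappa> > 0" "\<kappa> \<le> ln (real k) / 2" "\<kappa> \<le> l0 * (z1 - z)"
    using ln_k_pos l0 z1 by (auto simp: \<kappa>_def)
  have "ereal (ln (real k) - \<kappa>) < ereal (ln (real k))" using \<kappa> by simp
  also note rz
  finally obtain l where l: "integrable \<mu> (\<lambda>y. exp (l * y))" "cmgf z1 l < exp (- (ln (real k) - \<kappa>))"
    by (rule less_rate_imp)
  have "exp (- (ln (real k) - \<kappa>)) \<le> e" using \<kappa> by (simp add: e_def)
  with l cmgf_ge[OF l(1), of z1] have "1 + l * (mean - z1) < e" by simp
  then have "- l * (mean - z1) > 1 - e" by simp
  then have ll: "- l > l0" using zm by (simp add: l0_def field_simps)
  have "l0 * (z1 - z) \<le> - l * (z1 - z)" using ll z1 by (intro mult_right_mono) auto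
  then have le: "l * (z1 - z) \<le> - \<kappa>" using \<kappa> by simp
  have "cmgf z l = exp (l * (z1 - z)) * cmgf z1 l" by (rule cmgf_shift)
  also have "\<dots> < exp (l * (z1 - z)) * exp (- (ln (real k) - \<kappa>))" using l by simp
  also have "\<dots> \<le> exp (- \<kappa>) * exp (- (ln (real k) - \<kappa>))" using le by simp
  also have "\<dots> = exp (- ln (real k))" by (simp only: exp_add[symmetric]) simp
  also have "\<dots> = 1 / k" using k2 by (simp add: exp_minus inverse_eq_divide)
  finally have "k * cmgf z l < 1" using k2 by (simp add: field_simps)
  moreover have "l \<le> 0" using ll l0 by simp
  ultimately show ?thesis using that by blast
qed

text \<open>At the level \<open>z * m\<close> the first moment bound is
  \<open>(k * cmgf z l) ^ m\<close>, which decays geometrically.\<close>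

lemma tail_below_speed:
  assumes "z < \<gamma>"
  shows "(\<lambda>m. q m (z * real m)) \<longlonglongrightarrow> 1"
proof -
  obtain l where l: "l \<le> 0" "k * cmgf z l < 1" using chernoff_below_speed[OF assms] .
  have pos: "k * cmgf z l > 0" using cmgf_pos[OF integrable_exp_neg[OF l(1)]] k2 by simp
  have "1 - q m (z * real m) \<le> (k * cmgf z l) ^ m" for m
  proof -
    have "1 - q m (z * real m) \<le> exp (- l * (z * real m)) * (k * cmgf 0 l) ^ m"
      using tail_lower_deviation[OF l(1), of m "z * real m"] by (simp add: cmgf_def)
    also have "\<dots> = (k * cmgf z l) ^ m"
      unfolding cmgf_shift[of z l 0]
      by (simp add: power_mult_distrib exp_of_nat_mult[symmetric] mult_ac)
    finally show ?thesis .
  qed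
  then have lower: "1 - (k * cmgf z l) ^ m \<le> q m (z * real m)" for m
    by (simp add: algebra_simps)
  have "(\<lambda>m. (k * cmgf z l) ^ m) \<longlonglongrightarrow> 0" using l pos by (intro LIMSEQ_power_zero) (simp only: real_norm_def abs_of_pos)
  then have "(\<lambda>m. 1 - (k * cmgf z l) ^ m) \<longlonglongrightarrow> 1 - 0" by (intro tendsto_diff tendsto_const)
  then have lim: "(\<lambda>m. 1 - (k * cmgf z l) ^ m) \<longlonglongrightarrow> 1" by simp
  show ?thesis
  proof (rule tendsto_sandwich[OF _ _ lim tendsto_const])
    show "\<forall>\<^sub>F m in sequentially. 1 - (k * cmgf z l) ^ m \<le> q m (z * real m)"
      by (intro always_eventually allI lower)
    show "\<forall>\<^sub>F m in sequentially. q m (z * real m) \<le> 1"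
      by (intro always_eventually allI tail_le_1)
  qed
qed

section \<open>Tilting above the speed\<close>

lemma continuous_tilted_mean:
  "continuous_on {- L..0} (\<lambda>l. \<integral>y. (y - z) * exp (l * (y - z)) \<partial>\<mu>)"
proof -
  have "(\<lambda>n. \<integral>y. (y - z) * exp (x n * (y - z)) \<partial>\<mu>) \<longlonglongrightarrow> (\<integral>y. (y - z) * exp (a * (y - z)) \<partial>\<mu>)"
    if x: "x \<longlonglongrightarrow> a" "\<And>n. x n \<in> {- L..0}" for x a
  proof (rule integral_dominated_convergence)
    \<comment> \<open>For \<open>y \<ge> 0\<close> one has
      \<open>y - z \<ge> - \<bar>z\<bar>\<close>, so every tilt between \<open>- L\<close> and 0 is
      at most \<open>exp (L * \<bar>z\<bar>)\<close>.\<close>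
    show "integrable \<mu> (\<lambda>y. \<bar>y - z\<bar> * exp (L * \<bar>z\<bar>))" using integrable_id by auto
    show "AE y in \<mu>. (\<lambda>n. (y - z) * exp (x n * (y - z))) \<longlonglongrightarrow> (y - z) * exp (a * (y - z))"
      using x by (intro AE_I2 tendsto_intros)
    show "AE y in \<mu>. norm ((y - z) * exp (x n * (y - z))) \<le> \<bar>y - z\<bar> * exp (L * \<bar>z\<bar>)" for n
      using nonneg
    proof eventually_elim
      case (elim y)
      have xn: "- L \<le> x n" "x n \<le> 0" using x(2)[of n] by auto
      have "x n * (y - z) \<le> - x n * \<bar>z\<bar>"
        using mult_left_mono_neg[OF _ xn(2), of "- \<bar>z\<bar>" "y - z"] elim by simp
      also have "\<dots> \<le> L * \<bar>z\<bar>" using xn by (intro mult_right_mono) auto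
      finally show ?case by (auto simp: abs_mult intro!: mult_left_mono)
    qed
  qed auto
  then show ?thesis by (auto simp: continuous_on_sequentially o_def)
qed

text \<open>The tilted mean of \<open>Y - z\<close> is nonnegative at \<open>l = 0\<close> because
  \<open>z \<le> mean\<close>, and nonpositive for very negative \<open>l\<close> because there is
  mass below \<open>z\<close>; continuity gives a zero between.\<close>

lemma tilt_above_speed:
  assumes "w > \<gamma>"
  obtains z l where "z < w" "l \<le> 0" "k * cmgf z l > 1" "(\<integral>y. (y - z) * exp (l * (y - z)) \<partial>\<mu>) = 0"
proof -
  obtain z0 where z0: "z0 \<in> subcritical" "z0 < w"
    using assms mean_subcritical cInf_lessD[of subcritical w] by (auto simp: speed_eq)
  have super: "k * cmgf z0 l > 1" if "l \<le> 0" for l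
    using z0 integrable_exp_neg[OF that] by (intro rate_less_imp) (auto simp: subcritical_def)
  show ?thesis
  proof (cases "z0 = mean")
    case True
    then show ?thesis
      using z0 super[of 0] integrable_id by (intro that[of z0 0]) (auto simp: mean_def)
  next
    case False
    then have z0m: "z0 < mean" using z0 by (simp add: subcritical_def)
    \<comment> \<open>Moving above \<open>z0\<close> guarantees mass strictly below
      \<open>z\<close>, and for \<open>l \<le> 0\<close> it can only increase
      \<open>cmgf\<close>.\<close>
    define z where "z = min ((z0 + w) / 2) mean"
    have z: "z0 < z" "z < w" "z \<le> mean" using z0 z0m by (auto simp: z_def min_less_iff_disj)
    define c where "c = (z - z0) / 2"
    have c: "c > 0" "z0 < z - c" using z by (auto simp: c_def field_simps)
    define p where "p = prob {..z - c}"
    have p: "p > 0"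
    proof -
      have "\<not> (AE y in \<mu>. z - c \<le> y)" using z0 c by (intro not_AE_ge_of_subcritical)
      moreover have "AE y in \<mu>. z - c \<le> y" if "AE y in \<mu>. y \<notin> {..z - c}"
        using that by eventually_elim auto
      ultimately have "\<not> (AE y in \<mu>. y \<notin> {..z - c})" by blast
      then have "p \<noteq> 0" unfolding p_def by (subst prob_eq_0) auto
      then show ?thesis by (simp add: p_def less_le)
    qed
    define F where "F = (\<lambda>l. \<integral>y. (y - z) * exp (l * (y - z)) \<partial>\<mu>)"
    define a where "a = (\<integral>y. \<bar>y - z\<bar> \<partial>\<mu>)"
    have a: "a \<ge> 0" by (simp add: a_def)
    \<comment> \<open>By \<open>exp (L * c) \<ge> L * c\<close>, the mass \<open>p\<close> then
      contributes at most \<open>- a\<close>, offsetting the absolute moment.\<close>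
    define L where "L = a / (c\<^sup>2 * p)"
    have L: "L \<ge> 0" using a p by (simp add: L_def)
    have int: "integrable \<mu> (indicator {..z - c} :: real \<Rightarrow> real)"
      by (intro integrable_const_bound[of _ 1]) auto
    have "F (- L) \<le> (\<integral>y. \<bar>y - z\<bar> - c * exp (L * c) * indicator {..z - c} y \<partial>\<mu>)"
      unfolding F_def
    proof (rule integral_mono)
      fix y
      show "(y - z) * exp (- L * (y - z)) \<le> \<bar>y - z\<bar> - c * exp (L * c) * indicator {..z - c} y"
      proof (cases "y \<le> z - c")
        case True
        have "c * exp (L * c) \<le> (z - y) * exp (- L * (y - z))"
        proof (rule mult_mono)
          show "c \<le> z - y" using True by simp
          then have "L * c \<le> L * (z - y)" using L by (rule mult_left_mono)
          then show "exp (L * c) \<le> exp (- L * (y - z))" by (simp add: algebra_simps)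
        qed (use True c in auto)
        then show ?thesis using True c by (simp add: algebra_simps)
      next
        case y: False
        have "(y - z) * exp (- L * (y - z)) \<le> \<bar>y - z\<bar>"
        proof (cases "y \<ge> z")
          case True
          then have "exp (- L * (y - z)) \<le> 1" using L by simp
          with True show ?thesis by (simp add: mult_left_le)
        next
          case False
          then have "(y - z) * exp (- L * (y - z)) \<le> 0" by (intro mult_nonpos_nonneg) auto
          then show ?thesis by simp
        qed
        with y show ?thesis by simp
      qed
    qed (use integrable_exp_centred[of "- L" z] L integrable_id int in auto)
    also have "\<dots> = a - c * exp (L * c) * p"
      using integrable_id int by (simp add: a_def p_def)
    also have "\<dots> \<le> a - c * (L * c) * p"
    proof -
      have "L * c \<le> exp (L * c)" using exp_ge_add_one_self[of "L * c"] by linarith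
      then show ?thesis using c p by (intro diff_left_mono mult_right_mono mult_left_mono) auto
    qed
    also have "\<dots> = 0" using c p by (simp add: L_def power2_eq_square)
    finally have F1: "F (- L) \<le> 0" .
    have F0: "F 0 \<ge> 0" using z integrable_id by (simp add: F_def mean_def)
    obtain l where l: "- L \<le> l" "l \<le> 0" "F l = 0"
      using IVT'[of F "- L" 0 0] F1 F0 L continuous_tilted_mean[of L z] unfolding F_def by auto
    have "1 < k * cmgf z0 l" using l by (intro super)
    also have "\<dots> \<le> k * cmgf z l"
    proof -
      have "cmgf z l = exp (l * (z0 - z)) * cmgf z0 l" by (rule cmgf_shift)
      moreover have "exp (l * (z0 - z)) \<ge> 1" using l z by (simp add: mult_nonpos_nonpos)
      moreover have "cmgf z0 l > 0" using cmgf_pos[OF integrable_exp_neg[OF l(2)]] .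
      ultimately have "cmgf z0 l \<le> cmgf z l" by simp
      then show ?thesis by (simp add: mult_left_mono)
    qed
    finally show ?thesis using l z by (intro that[of z l]) (auto simp: F_def)
  qed
qed

text \<open>Among \<open>k\<close> branches, each low with probability at least \<open>A\<close>,
  some branch is low with probability close to \<open>k * A\<close> when this is small;
  \<open>t\<close> measures the loss.\<close>

lemma tail_Suc_lower:
  fixes A t x :: real
  assumes A: "A \<le> (\<integral>y. 1 - q m (x - y) \<partial>\<mu>)" and t: "k * A \<le> t" "t > 0"
  shows "k * A / (1 + t) \<le> 1 - q (Suc m) x"
proof (cases "A \<le> 0")
  case True
  then have "k * A / (1 + t) \<le> 0" using t by (simp add: mult_nonneg_nonpos divide_nonpos_pos)
  then show ?thesis using tail_le_1[of "Suc m" x] by linarith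
next
  case False
  define c where "c = (\<integral>y. q m (x - y) \<partial>\<mu>)"
  have "(\<integral>y. 1 - q m (x - y) \<partial>\<mu>) = 1 - c"
    unfolding c_def using integrable_tail by simp
  then have A1: "c \<le> 1 - A" "c \<ge> 0" using A integral_tail[of m x] by (auto simp: c_def)
  have kA: "k * A > 0" using False k2 by simp
  \<comment> \<open>Bernoulli's inequality for \<open>1 + A\<close> and
    \<open>(1 - A) * (1 + A) \<le> 1\<close> replace an expansion of
    \<open>(1 - A) ^ k\<close>.\<close>
  have "c ^ k * (1 + k * A) \<le> (1 - A) ^ k * (1 + A) ^ k"
    using A1 False Bernoulli_inequality[of A k] by (intro mult_mono power_mono) auto
  also have "\<dots> = (1 - A\<^sup>2) ^ k" by (simp add: power_mult_distrib[symmetric] power2_eq_square algebra_simps)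
  also have "\<dots> \<le> 1"
  proof (rule power_le_one)
    have "A\<^sup>2 \<le> 1" using A1 False by (intro power_le_one) auto
    then show "0 \<le> 1 - A\<^sup>2" by simp
  qed simp
  finally have "c ^ k \<le> 1 / (1 + k * A)" using kA by (simp add: field_simps)
  also have "\<dots> = 1 - k * A / (1 + k * A)" using kA by (simp add: field_simps)
  finally have "k * A / (1 + k * A) \<le> 1 - c ^ k" by simp
  moreover have "k * A / (1 + t) \<le> k * A / (1 + k * A)"
    using kA t by (intro divide_left_mono) auto
  ultimately show ?thesis by (simp add: c_def)
qed

subsection \<open>Law of large numbers and asymptotics\<close>

text \<open>A probability \<open>s\<close> of being low reproduces itself after \<open>n\<close>
  generations. The growth of the linearised recursion pays for the width and the shrinking of the
  bump, and the spare speed \<eta> for its offset.\<close>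

lemma tail_block:
  assumes l: "l \<le> 0" and super: "k * cmgf z l > 1"
    and tilt: "(\<integral>y. (y - z) * exp (l * (y - z)) \<partial>\<mu>) = 0" and \<eta>: "\<eta> > 0"
  obtains n s0 where "n > 0" "s0 > 0"
    "\<And>s m a. 0 < s \<Longrightarrow> s \<le> s0 \<Longrightarrow> s \<le> 1 - q m a \<Longrightarrow> s \<le> 1 - q (m + n) (a + real n * (z + \<eta>))"
proof -
  define \<phi> where "\<phi> = cmgf z l"
  define \<phi>2 where "\<phi>2 = (\<integral>y. (y - z)\<^sup>2 * exp (l * (y - z)) \<partial>\<mu>)"
  define v where "v = \<phi>2 / \<phi>"
  \<comment> \<open>Half of the excess of \<open>k * \<phi>\<close> over 1 is given up for the
    nonlinearity; the remaining factor is \<open>\<rho> = (1 + 2 * t) / (1 + t) > 1\<close>.\<close>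
  define t where "t = (k * \<phi> - 1) / 2"
  define \<rho> where "\<rho> = k * \<phi> / (1 + t)"
  \<comment> \<open>The first bound keeps the offset \<open>n * h1\<close> within
    \<open>n * \<eta>\<close>; the second makes \<open>exp (l * h)\<close> cost at most the square
    root of \<open>\<rho> ^ n\<close>.\<close>
  define h1 where "h1 = min \<eta> (ln \<rho> / (2 * (1 - l)))"
  have \<phi>: "\<phi> > 0" unfolding \<phi>_def by (rule cmgf_pos[OF integrable_exp_neg[OF l]])
  have v: "v \<ge> 0" unfolding v_def \<phi>2_def using \<phi> by (intro divide_nonneg_pos integral_nonneg_AE) auto
  have t: "t > 0" using super by (simp add: t_def \<phi>_def)
  have \<rho>: "\<rho> > 1" using t by (simp add: \<rho>_def t_def field_simps)
  have ln\<rho>: "ln \<rho> > 0" using \<rho> by simp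
  have h1: "h1 > 0" "h1 \<le> \<eta>" using \<eta> ln\<rho> l by (auto simp: h1_def)
  have lh1: "- l * h1 \<le> ln \<rho> / 2"
  proof -
    have "- l * h1 \<le> (1 - l) * (ln \<rho> / (2 * (1 - l)))" using l h1 by (intro mult_mono) (auto simp: h1_def)
    also have "\<dots> = ln \<rho> / 2" using l by (simp add: field_simps)
    finally show ?thesis .
  qed
  \<comment> \<open>The first bound limits the variance loss \<open>n * v\<close> to
    \<open>R / 2\<close>; the second makes the net growth \<open>\<rho> ^ n * exp (l * h)\<close> at
    least 2.\<close>
  obtain n :: nat where n: "n > 0" "real n \<ge> 2 * v / h1\<^sup>2" "real n \<ge> 2 / ln \<rho>"
  proof -
    obtain n :: nat where "real n \<ge> max (2 * v / h1\<^sup>2) (2 / ln \<rho>)" using real_arch_simple by blast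
    moreover have "2 / ln \<rho> > 0" using ln\<rho> by simp
    ultimately show ?thesis by (intro that[of n]) (auto intro: Nat.gr0I)
  qed
  define h where "h = n * h1"
  define R where "R = h\<^sup>2"
  have h: "h > 0" using n h1 by (simp add: h_def)
  have R: "R > 0" using h by (simp add: R_def)
  have vR: "n * v / R \<le> 1 / 2"
  proof -
    have "2 * v \<le> n * h1\<^sup>2" using n h1 by (simp add: field_simps)
    then have "2 * (n * v) \<le> R" unfolding R_def h_def power_mult_distrib power2_eq_square[of "real n"]
      using n by (simp add: mult_ac)
    then show ?thesis using R by (simp add: field_simps)
  qed
  \<comment> \<open>Averaging \<open>B s j\<close> over a centred step and multiplying by \<open>k / (1 + t)\<close> gives \<open>B s (Suc j)\<close>: the linear
    term vanishes by \<open>tilt\<close> and the variance only shrinks the bump by \<open>v\<close>.\<close>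
  define B where "B = (\<lambda>s (j::nat) x. s * \<rho> ^ j * exp (l * h) / R * (exp (- l * x) * (R - x\<^sup>2 - j * v)))"
  have B_neg: "B s j x \<le> 0" if "s > 0" "R \<le> x\<^sup>2 + j * v" for s j x
    unfolding B_def using that \<rho> R by (intro mult_nonneg_nonpos mult_nonneg_nonpos) auto
  \<comment> \<open>This explains the normalisation \<open>exp (l * h) / R\<close>: where the bump
    is positive, \<open>x \<le> h\<close> and the quadratic factor is at most
    \<open>R\<close>.\<close>
  have B_le: "B s j x \<le> s * \<rho> ^ j" if s: "s > 0" for s j x
  proof (cases "R \<le> x\<^sup>2 + j * v")
    case True
    then show ?thesis using B_neg[OF s True] \<rho> s
      by (meson less_imp_le order_trans mult_nonneg_nonneg zero_le_power zero_le_one)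
  next
    case False
    then have "x\<^sup>2 \<le> h\<^sup>2" using v by (smt (verit) R_def of_nat_0_le_iff mult_nonneg_nonneg)
    then have "x \<le> h" using h by (meson less_imp_le abs_le_square_iff abs_le_D1 abs_of_pos order_trans power2_le_imp_le)
    then have "exp (l * h) * exp (- l * x) \<le> 1"
      using mult_left_mono_neg[OF \<open>x \<le> h\<close> l] by (simp add: exp_add[symmetric])
    moreover have "(R - x\<^sup>2 - j * v) / R \<le> 1" using R v by (simp add: field_simps)
    moreover have "0 \<le> (R - x\<^sup>2 - j * v) / R" using False R by simp
    ultimately have "exp (l * h) * exp (- l * x) * ((R - x\<^sup>2 - j * v) / R) \<le> 1 * 1"
      by (intro mult_mono) auto
    then have "(s * \<rho> ^ j) * (exp (l * h) * exp (- l * x) * ((R - x\<^sup>2 - j * v) / R)) \<le> s * \<rho> ^ j * 1"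
      using s \<rho> by (intro mult_left_mono) auto
    then show ?thesis by (simp add: B_def mult_ac)
  qed
  have B_int: "integrable \<mu> (\<lambda>y. B s j (x - (y - z)))"
    "(\<integral>y. B s j (x - (y - z)) \<partial>\<mu>) = \<phi> / \<rho> * B s (Suc j) x" for s j x
  proof -
    define c where "c = s * \<rho> ^ j * exp (l * h) / R * exp (- l * x)"
    have eq: "B s j (x - (y - z)) = c * ((R - x\<^sup>2 - j * v) * exp (l * (y - z))
        + 2 * x * ((y - z) * exp (l * (y - z))) - (y - z)\<^sup>2 * exp (l * (y - z)))" for y
    proof -
      have "exp (- l * (x - (y - z))) = exp (- l * x) * exp (l * (y - z))"
        by (simp add: exp_add[symmetric] algebra_simps)
      then show ?thesis unfolding B_def c_def by (simp add: algebra_simps power2_eq_square)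
    qed
    note ints = integrable_exp_centred[OF l, of z]
    show "integrable \<mu> (\<lambda>y. B s j (x - (y - z)))"
      unfolding eq using ints by (intro integrable_mult_right Bochner_Integration.integrable_diff Bochner_Integration.integrable_add) auto
    have "(\<integral>y. B s j (x - (y - z)) \<partial>\<mu>) = c * ((R - x\<^sup>2 - j * v) * \<phi> + 2 * x * 0 - \<phi>2)"
      unfolding eq using ints by (simp add: tilt \<phi>_def cmgf_def \<phi>2_def)
    also have "\<phi>2 = v * \<phi>" using \<phi> by (simp add: v_def)
    also have "c * ((R - x\<^sup>2 - j * v) * \<phi> + 2 * x * 0 - v * \<phi>) = \<phi> * (c * (R - x\<^sup>2 - Suc j * v))"
      by (simp add: algebra_simps)
    also have "c * (R - x\<^sup>2 - Suc j * v) = B s (Suc j) x / \<rho>"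
    proof -
      have "\<rho> * (c * (R - x\<^sup>2 - Suc j * v)) = B s (Suc j) x" unfolding B_def c_def by (simp add: mult_ac)
      then show ?thesis using \<rho> by (simp add: eq_divide_eq mult.commute)
    qed
    finally show "(\<integral>y. B s j (x - (y - z)) \<partial>\<mu>) = \<phi> / \<rho> * B s (Suc j) x" by simp
  qed
  \<comment> \<open>Keeps \<open>k * A \<le> t\<close> throughout the \<open>n\<close> generations
    of growth.\<close>
  define s0 where "s0 = t / (k * \<phi> * \<rho> ^ n)"
  have k\<phi>: "k * \<phi> > 0" using \<phi> k2 by simp
  have s0: "s0 > 0" using t k\<phi> \<rho> by (simp add: s0_def)
  have "s \<le> 1 - q (m + n) (a + real n * (z + \<eta>))" if s: "0 < s" "s \<le> s0" "s \<le> 1 - q m a" for s m a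
  proof -
    \<comment> \<open>The bump starts centred at \<open>a + h\<close>, so its positive part lies
      above \<open>a\<close>, where the hypothesis on \<open>q m a\<close> applies.\<close>
    have "B s j x \<le> 1 - q (m + j) (a + h + j * z + x)" if "j \<le> n" for j x
      using that
    proof (induction j arbitrary: x)
      case 0
      show ?case
      proof (cases "x < - h")
        case True
        then have "R \<le> x\<^sup>2" unfolding R_def using h by (simp add: abs_le_square_iff[symmetric])
        then have "B s 0 x \<le> 0" using s by (intro B_neg) auto
        then show ?thesis using tail_le_1[of m "a + h + x"] by simp
      next
        case False
        have "B s 0 x \<le> s" using B_le[OF s(1), of 0 x] by simp
        also have "s \<le> 1 - q m a" by (rule s(3))
        also have "\<dots> \<le> 1 - q m (a + h + x)" using False by (simp add: tail_antimono)
        finally show ?thesis by simp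
      qed
    next
      case (Suc j)
      define x' where "x' = a + h + Suc j * z + x"
      define A where "A = \<phi> / \<rho> * B s (Suc j) x"
      have "A = (\<integral>y. B s j (x - (y - z)) \<partial>\<mu>)" by (simp add: A_def B_int)
      also have "\<dots> \<le> (\<integral>y. 1 - q (m + j) (x' - y) \<partial>\<mu>)"
      proof (rule integral_mono)
        show "B s j (x - (y - z)) \<le> 1 - q (m + j) (x' - y)" for y
          using Suc.IH[of "x - (y - z)"] Suc.prems by (simp add: x'_def algebra_simps)
      qed (use B_int integrable_tail in auto)
      finally have A1: "A \<le> (\<integral>y. 1 - q (m + j) (x' - y) \<partial>\<mu>)" .
      have "A \<le> \<phi> / \<rho> * (s * \<rho> ^ Suc j)"
        unfolding A_def using B_le[OF s(1), of "Suc j" x] \<phi> \<rho> by (intro mult_left_mono) auto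
      also have "\<dots> = \<phi> * s * \<rho> ^ j" using \<rho> by simp
      also have "\<dots> \<le> \<phi> * s0 * \<rho> ^ n"
        using \<phi> s \<rho> Suc.prems by (intro mult_mono power_increasing) auto
      finally have "k * A \<le> k * (\<phi> * s0 * \<rho> ^ n)" by (intro mult_left_mono) auto
      also have "\<dots> = t" using \<phi> k2 \<rho> by (simp add: s0_def)
      finally have A2: "k * A \<le> t" .
      have "B s (Suc j) x = k * A / (1 + t)"
      proof -
        have "k * A / (1 + t) = \<rho> * B s (Suc j) x / \<rho>" by (simp add: A_def \<rho>_def)
        then show ?thesis using \<rho> by simp
      qed
      also have "\<dots> \<le> 1 - q (Suc (m + j)) x'" using A1 A2 t by (rule tail_Suc_lower)
      finally show ?case by (simp add: x'_def)
    qed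
    \<comment> \<open>At its centre the final bump is at least \<open>s\<close>: the growth is at
      least 2 and the quadratic factor over \<open>R\<close> at least 1/2.\<close>
    from this[of n 0] have "B s n 0 \<le> 1 - q (m + n) (a + h + n * z)" by simp
    also have "\<dots> \<le> 1 - q (m + n) (a + real n * (z + \<eta>))"
    proof -
      have "h \<le> n * \<eta>" using h1 by (simp add: h_def mult_left_mono)
      then show ?thesis by (simp add: tail_antimono algebra_simps)
    qed
    finally have Bn: "B s n 0 \<le> 1 - q (m + n) (a + real n * (z + \<eta>))" .
    have "2 \<le> \<rho> ^ n * exp (l * h)"
    proof -
      have "- l * h1 * n \<le> ln \<rho> / 2 * n" using lh1 by (intro mult_right_mono) auto
      then have "- l * h \<le> n * (ln \<rho> / 2)" by (simp add: h_def mult_ac)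
      moreover have "1 \<le> n * (ln \<rho> / 2)" using n ln\<rho> by (simp add: field_simps)
      ultimately have "1 \<le> n * ln \<rho> + l * h" by (simp add: field_simps)
      then have "2 \<le> exp (n * ln \<rho> + l * h)" using exp_ge_add_one_self[of "n * ln \<rho> + l * h"] by linarith
      also have "\<dots> = \<rho> ^ n * exp (l * h)" using \<rho> by (simp add: exp_add exp_of_nat_mult)
      finally show ?thesis .
    qed
    moreover have "1 / 2 \<le> 1 - n * v / R" using vR by simp
    ultimately have "2 * (1 / 2) \<le> (\<rho> ^ n * exp (l * h)) * (1 - n * v / R)"
      using \<rho> by (intro mult_mono) auto
    then have "s * 1 \<le> s * ((\<rho> ^ n * exp (l * h)) * (1 - n * v / R))" using s by (intro mult_left_mono) auto
    also have "1 - n * v / R = (R - n * v) / R" using R by (simp add: diff_divide_distrib)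
    also have "s * ((\<rho> ^ n * exp (l * h)) * ((R - n * v) / R)) = B s n 0" by (simp add: B_def)
    finally show ?thesis using Bn by simp
  qed
  with n(1) s0 show ?thesis using that by blast
qed

section \<open>Convergence to 0 above the speed\<close>

lemma tail_tendsto_0: "(q m \<longlongrightarrow> 0) at_top"
proof -
  define b where "b = \<alpha> / 2"
  have b: "0 < b" "b < \<alpha>" using \<alpha>_pos by (auto simp: b_def)
  obtain D where D: "D \<ge> 0" "\<And>x. q m x \<le> (D * exp (- b * x)) ^ k"
    using tail_exp_bound_ex[OF b(1) integrable_exp[OF b]] by blast
  have "((\<lambda>x. exp (- b * x)) \<longlongrightarrow> 0) at_top" using b by real_asymp
  then have "((\<lambda>x. (D * exp (- b * x)) ^ k) \<longlongrightarrow> (D * 0) ^ k) at_top" by (intro tendsto_intros)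
  then have lim: "((\<lambda>x. (D * exp (- b * x)) ^ k) \<longlongrightarrow> 0) at_top" using k2 by (simp add: zero_power)
  show ?thesis
  proof (rule tendsto_sandwich[OF _ _ tendsto_const lim])
    show "\<forall>\<^sub>F x in at_top. 0 \<le> q m x" by (intro always_eventually allI tail_nonneg)
    show "\<forall>\<^sub>F x in at_top. q m x \<le> (D * exp (- b * x)) ^ k" by (intro always_eventually allI D)
  qed
qed

lemma tail_above_speed_bounded:
  assumes "w > \<gamma>"
  obtains r where "0 < r" "r < 1" "\<forall>\<^sub>F m in sequentially. q m (w * real m) \<le> r"
proof -
  define w1 where "w1 = (\<gamma> + w) / 2"
  have w1: "\<gamma> < w1" "w1 < w" using assms by (auto simp: w1_def)
  obtain z l where z: "z < w1" "l \<le> 0" "k * cmgf z l > 1" "(\<integral>y. (y - z) * exp (l * (y - z)) \<partial>\<mu>) = 0"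
    using tilt_above_speed[OF w1(1)] .
  obtain n s0 where n: "n > 0" "s0 > 0"
    and block: "\<And>s m a. 0 < s \<Longrightarrow> s \<le> s0 \<Longrightarrow> s \<le> 1 - q m a \<Longrightarrow> s \<le> 1 - q (m + n) (a + real n * w1)"
    using tail_block[OF z(2-4), of "w1 - z"] z(1) by (auto simp: algebra_simps)
  define s where "s = min s0 (1 / 2)"
  have s: "0 < s" "s \<le> s0" "s \<le> 1 / 2" using n by (auto simp: s_def)
  have ev1: "\<forall>\<^sub>F a in at_top. q i (a + real i * w1) \<le> 1 / 2" for i
  proof -
    have "\<forall>\<^sub>F y in at_top. q i y < 1 / 2" using tail_tendsto_0[of i] by (rule order_tendstoD) simp
    then obtain y0 where y0: "\<And>y. y \<ge> y0 \<Longrightarrow> q i y < 1 / 2" by (auto simp: eventually_at_top_linorder)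
    show ?thesis using eventually_ge_at_top[of "y0 - real i * w1"]
      by eventually_elim (use y0 in \<open>auto intro: less_imp_le\<close>)
  qed
  have "\<forall>\<^sub>F a in at_top. \<forall>i\<in>{..<n}. q i (a + real i * w1) \<le> 1 / 2"
    by (intro eventually_ball_finite finite_lessThan ballI ev1)
  \<comment> \<open>A single offset \<open>a\<close> serves the first \<open>n\<close> generations;
    all later ones are reached by jumps of length \<open>n\<close>.\<close>
  then obtain a where a: "\<And>i. i < n \<Longrightarrow> q i (a + real i * w1) \<le> 1 / 2"
    by (metis (mono_tags, lifting) eventually_happens' lessThan_iff trivial_limit_at_top_linorder)
  have all: "s \<le> 1 - q m (a + real m * w1)" for m
  proof (induction m rule: less_induct)
    case (less m)
    show ?case
    proof (cases "m < n")
      case True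
      then show ?thesis using a[of m] s by simp
    next
      case False
      have "s \<le> 1 - q (m - n) (a + real (m - n) * w1)" using n False by (intro less) auto
      from block[OF s(1,2) this] show ?thesis using False by (simp add: algebra_simps of_nat_diff)
    qed
  qed
  have "\<forall>\<^sub>F m in sequentially. a + real m * w1 \<le> w * real m"
    using w1 by real_asymp
  then have "\<forall>\<^sub>F m in sequentially. q m (w * real m) \<le> 1 - s"
  proof eventually_elim
    case (elim m)
    then show ?case using all[of m] tail_antimono[OF elim, of m] by linarith
  qed
  with s show ?thesis by (intro that[of "1 - s"]) auto
qed

text \<open>The recursion raises its bound to a power \<open>k \<ge> 2\<close>. Steps beyond a
  constant \<open>B\<close> are allowed for by relaxing \<open>r\<close> to
  \<open>r powr (3 / 4)\<close>, whose square still improves on \<open>r\<close>.\<close>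

lemma tail_boost:
  assumes r: "0 < r" "r < 1" and w: "w1 < w"
    and ev: "\<forall>\<^sub>F m in sequentially. q m (w1 * real m) \<le> r"
  shows "\<forall>\<^sub>F m in sequentially. q m (w * real m) \<le> r powr (3 / 2)"
proof -
  define b where "b = r powr (3 / 4) - r"
  have b: "b > 0" using powr_less_mono'[of r "3 / 4" 1] r by (simp add: b_def)
  have "((\<lambda>x. exp (- (\<alpha> - \<alpha> / 2) * x)) \<longlongrightarrow> 0) at_top" using \<alpha>_pos by real_asymp
  then have "\<forall>\<^sub>F x in at_top. exp (- (\<alpha> - \<alpha> / 2) * x) < b" using b by (rule order_tendstoD)
  moreover have "\<forall>\<^sub>F x in at_top. prob {x..} \<le> exp (- (\<alpha> - \<alpha> / 2) * x)"
    using eventually_tail_probability[of "\<alpha> / 2"] \<alpha>_pos by (auto elim: eventually_mono)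
  ultimately have "\<forall>\<^sub>F x in at_top. prob {x..} \<le> b"
    by eventually_elim linarith
  then obtain B where B: "prob {B..} \<le> b"
    by (metis (mono_tags, lifting) eventually_happens' trivial_limit_at_top_linorder)
  have "\<forall>\<^sub>F m in sequentially. w1 * real m + B \<le> w * real (Suc m)" using w by real_asymp
  with ev have "\<forall>\<^sub>F m in sequentially. q (Suc m) (w * real (Suc m)) \<le> r powr (3 / 2)"
  proof eventually_elim
    case (elim m)
    have "q (Suc m) (w * real (Suc m)) \<le> q (Suc m) (w1 * real m + B)" using elim by (intro tail_antimono)
    also have "\<dots> \<le> (q m (w1 * real m) + prob {B..}) ^ k" by (rule tail_Suc_le)
    also have "\<dots> \<le> (r powr (3 / 4)) ^ k"
      using elim B tail_nonneg by (intro power_mono add_nonneg_nonneg) (auto simp: b_def)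
    also have "\<dots> \<le> (r powr (3 / 4)) ^ 2"
      using r k2 by (intro power_decreasing) (auto intro: powr_le1)
    also have "\<dots> = r powr (3 / 2)" using r by (simp add: powr_add[symmetric] power2_eq_square)
    finally show ?case .
  qed
  then show ?thesis by (subst (asm) eventually_sequentially_Suc[of "\<lambda>m. q m (w * real m) \<le> r powr (3 / 2)"])
qed

lemma tail_above_speed:
  assumes "w > \<gamma>" "\<tau> > 0"
  shows "\<forall>\<^sub>F m in sequentially. q m (w * real m) \<le> \<tau>"
proof -
  obtain r where r: "0 < r" "r < 1" and ev: "\<forall>\<^sub>F m in sequentially. q m ((\<gamma> + w) / 2 * real m) \<le> r"
    using tail_above_speed_bounded[of "(\<gamma> + w) / 2"] assms by auto
  \<comment> \<open>Each boost raises the speed slightly. Quantifying over \<open>w'\<close> lets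
    the induction pass through a speed between the midpoint and \<open>w'\<close>.\<close>
  have iter: "\<forall>\<^sub>F m in sequentially. q m (w' * real m) \<le> r powr ((3 / 2) ^ j)" if "w' > (\<gamma> + w) / 2" for j w'
    using that
  proof (induction j arbitrary: w')
    case 0
    have "\<forall>\<^sub>F m in sequentially. (\<gamma> + w) / 2 * real m \<le> w' * real m"
      using 0 by (intro always_eventually allI mult_right_mono) auto
    with ev show ?case
    proof eventually_elim
      case (elim m)
      then show ?case using tail_antimono[OF elim(2), of m] r by simp
    qed
  next
    case (Suc j)
    define w1 where "w1 = ((\<gamma> + w) / 2 + w') / 2"
    have w1: "(\<gamma> + w) / 2 < w1" "w1 < w'" using Suc.prems by (auto simp: w1_def field_simps)
    have "r powr ((3 / 2) ^ j) < 1" using r powr_less_mono'[of r 0 "(3 / 2) ^ j"] by simp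
    from tail_boost[OF _ this w1(2) Suc.IH[OF w1(1)]] show ?case
      using r by (simp add: powr_powr mult.commute)
  qed
  have "filterlim (\<lambda>j::nat. (3 / 2 :: real) ^ j) at_top sequentially" by real_asymp
  moreover have "((\<lambda>x. r powr x) \<longlongrightarrow> 0) at_top" using r by real_asymp
  ultimately have "(\<lambda>j. r powr ((3 / 2) ^ j)) \<longlonglongrightarrow> 0" by (rule filterlim_compose[rotated])
  then have "\<forall>\<^sub>F j in sequentially. r powr ((3 / 2) ^ j) < \<tau>" using assms(2) by (rule order_tendstoD)
  then obtain j where j: "r powr ((3 / 2) ^ j) < \<tau>" by (auto simp: eventually_sequentially)
  have "(\<gamma> + w) / 2 < w" using assms by (simp add: field_simps)
  from iter[OF this, of j] show ?thesis by eventually_elim (use j in auto)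
qed

section \<open>Exponential rates of the upper tail\<close>

lemma tail_upper_asymptotics:
  assumes \<epsilon>: "\<epsilon> > 0" and \<delta>: "\<delta> > 0"
  shows "\<exists>c>0. \<forall>\<^sub>F m in sequentially.
    q m ((\<gamma> + \<epsilon>) * real m) \<le> c * exp (- (k * \<alpha> * \<epsilon> * (1 - \<delta>) * real m))"
proof -
  \<comment> \<open>\<kappa> is spent twice, in \<open>b < \<alpha>\<close> and in
    \<open>w > \<gamma>\<close>, which gives the exponent factor \<open>(1 - \<kappa>)\<^sup>2 \<ge>
    1 - 2 * \<kappa> \<ge> 1 - \<delta>\<close>.\<close>
  define \<kappa> where "\<kappa> = min 1 \<delta> / 2"
  have \<kappa>: "0 < \<kappa>" "\<kappa> < 1" "2 * \<kappa> \<le> \<delta>" using \<delta> by (auto simp: \<kappa>_def)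
  define b where "b = \<alpha> * (1 - \<kappa>)"
  have b: "0 < b" "b < \<alpha>" using \<alpha>_pos \<kappa> by (auto simp: b_def)
  define w where "w = \<gamma> + \<epsilon> * \<kappa>"
  have "w > \<gamma>" using \<epsilon> \<kappa> by (simp add: w_def)
  then obtain C where C: "C > 0"
    "\<forall>\<^sub>F m in sequentially. \<forall>x. q m x \<le> (C * exp (b * (w * real m - x))) ^ k"
    using tail_exp_bound[OF b(1) integrable_exp[OF b] tail_above_speed] by blast
  have "\<forall>\<^sub>F m in sequentially. q m ((\<gamma> + \<epsilon>) * real m) \<le> C ^ k * exp (- (k * \<alpha> * \<epsilon> * (1 - \<delta>) * real m))"
    using C(2)
  proof eventually_elim
    case (elim m)
    have "q m ((\<gamma> + \<epsilon>) * real m) \<le> (C * exp (b * (w * real m - (\<gamma> + \<epsilon>) * real m))) ^ k" using elim by blast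
    also have "\<dots> = C ^ k * exp (- (k * \<alpha> * \<epsilon> * (1 - \<kappa>)\<^sup>2 * real m))"
      by (simp add: power_mult_distrib exp_of_nat_mult[symmetric] b_def w_def power2_eq_square algebra_simps)
    also have "\<dots> \<le> C ^ k * exp (- (k * \<alpha> * \<epsilon> * (1 - \<delta>) * real m))"
    proof -
      have "(1 - \<kappa>)\<^sup>2 = 1 - 2 * \<kappa> + \<kappa>\<^sup>2" by (simp add: power2_diff)
      then have "1 - \<delta> \<le> (1 - \<kappa>)\<^sup>2" using \<kappa> zero_le_power2[of \<kappa>] by linarith
      then have "k * \<alpha> * \<epsilon> * (1 - \<delta>) * real m \<le> k * \<alpha> * \<epsilon> * (1 - \<kappa>)\<^sup>2 * real m"
        using \<alpha>_pos \<epsilon> by (intro mult_right_mono mult_left_mono) auto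
      then show ?thesis using C by simp
    qed
    finally show ?case .
  qed
  with C(1) show ?thesis by (intro exI[of _ "C ^ k"]) auto
qed

lemma tail_lower_asymptotics:
  assumes \<epsilon>: "\<epsilon> > 0" and \<delta>: "\<delta> > 0"
  shows "\<exists>c>0. \<forall>\<^sub>F m in sequentially.
    c * exp (- (k * \<alpha> * \<epsilon> * (1 + \<delta>) * real m)) \<le> q m ((\<gamma> + \<epsilon>) * real m)"
proof -
  \<comment> \<open>\<kappa> enters both the displacement and the tail exponent, and \<open>(1 +
    \<kappa>)\<^sup>2 \<le> 1 + 3 * \<kappa> \<le> 1 + \<delta>\<close>.\<close>
  define \<kappa> where "\<kappa> = min 1 \<delta> / 3"
  have \<kappa>: "0 < \<kappa>" "\<kappa> < 1" "3 * \<kappa> \<le> \<delta>" using \<delta> by (auto simp: \<kappa>_def)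
  define z where "z = \<gamma> - \<epsilon> * \<kappa> / 2"
  have z: "z < \<gamma>" using \<epsilon> \<kappa> by (simp add: z_def)
  define X where "X = (\<lambda>m. \<epsilon> * (1 + \<kappa>) * real m)"
  have half: "\<forall>\<^sub>F m in sequentially. q m (z * real m) > 1 / 2"
    using tail_below_speed[OF z] by (rule order_tendstoD) simp
  have "filterlim (\<lambda>m. X (Suc m)) at_top sequentially"
    unfolding X_def using \<epsilon> \<kappa> by real_asymp
  moreover have "\<forall>\<^sub>F x in at_top. exp (- (\<alpha> + \<alpha> * \<kappa>) * x) \<le> prob {x..}"
    using eventually_tail_probability[of "\<alpha> * \<kappa>"] \<alpha>_pos \<kappa> by (auto elim: eventually_mono)
  ultimately have pr: "\<forall>\<^sub>F m in sequentially. exp (- (\<alpha> + \<alpha> * \<kappa>) * X (Suc m)) \<le> prob {X (Suc m)..}"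
    by (rule filterlim_iff[THEN iffD1, rule_format])
  \<comment> \<open>The extra displacement \<open>\<epsilon> * \<kappa>\<close> per generation
    covers the deficit \<open>\<epsilon> * \<kappa> / 2\<close> of \<open>z\<close> below \<gamma>,
    and for large \<open>m\<close> also the one generation that the subtrees lack.\<close>
  have le: "\<forall>\<^sub>F m in sequentially. (\<gamma> + \<epsilon>) * real (Suc m) \<le> X (Suc m) + z * real m"
  proof -
    have "\<epsilon> * \<kappa> / 2 > 0" using \<epsilon> \<kappa> by simp
    then have "filterlim (\<lambda>m. \<epsilon> * \<kappa> / 2 * real m) at_top sequentially"
      by (rule filterlim_tendsto_pos_mult_at_top[OF tendsto_const _ filterlim_real_sequentially])
    then have "\<forall>\<^sub>F m in sequentially. \<gamma> \<le> \<epsilon> * \<kappa> / 2 * real m"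
      by (simp add: filterlim_at_top)
    then show ?thesis
    proof eventually_elim
      case (elim m)
      have "X (Suc m) + z * real m - (\<gamma> + \<epsilon>) * real (Suc m) = \<epsilon> * \<kappa> / 2 * real m - \<gamma> + \<epsilon> * \<kappa>"
        by (simp add: X_def z_def algebra_simps)
      then show ?case using elim \<epsilon> \<kappa> by (smt (verit) mult_pos_pos)
    qed
  qed
  from half pr le have "\<forall>\<^sub>F m in sequentially. (1 / 2) ^ k * exp (- (k * \<alpha> * \<epsilon> * (1 + \<delta>) * real (Suc m)))
      \<le> q (Suc m) ((\<gamma> + \<epsilon>) * real (Suc m))"
  proof eventually_elim
    case (elim m)
    have "(1 + \<kappa>)\<^sup>2 = 1 + 2 * \<kappa> + \<kappa> * \<kappa>" by (simp add: power2_eq_square algebra_simps)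
    moreover have "\<kappa> * \<kappa> \<le> \<kappa>" using \<kappa> by (simp add: mult_left_le)
    ultimately have "(1 + \<kappa>)\<^sup>2 \<le> 1 + \<delta>" using \<kappa> by linarith
    then have "k * \<alpha> * \<epsilon> * (1 + \<kappa>)\<^sup>2 * real (Suc m) \<le> k * \<alpha> * \<epsilon> * (1 + \<delta>) * real (Suc m)"
      using \<alpha>_pos \<epsilon> by (intro mult_right_mono mult_left_mono) auto
    then have "(1 / 2) ^ k * exp (- (k * \<alpha> * \<epsilon> * (1 + \<delta>) * real (Suc m)))
        \<le> (1 / 2) ^ k * exp (- (k * \<alpha> * \<epsilon> * (1 + \<kappa>)\<^sup>2 * real (Suc m)))"
      by (intro mult_left_mono) auto
    also have "\<dots> = (exp (- (\<alpha> + \<alpha> * \<kappa>) * X (Suc m)) * (1 / 2)) ^ k"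
    proof -
      have "- (k * \<alpha> * \<epsilon> * (1 + \<kappa>)\<^sup>2 * real (Suc m)) = k * (- (\<alpha> + \<alpha> * \<kappa>) * X (Suc m))"
        by (simp add: X_def power2_eq_square algebra_simps)
      then show ?thesis by (simp only: power_mult_distrib exp_of_nat_mult mult.commute)
    qed
    also have "\<dots> \<le> (prob {X (Suc m)..} * q m (z * real m)) ^ k"
      using elim by (intro power_mono mult_mono) auto
    also have "\<dots> \<le> q (Suc m) (X (Suc m) + z * real m)" by (rule tail_Suc_ge)
    also have "\<dots> \<le> q (Suc m) ((\<gamma> + \<epsilon>) * real (Suc m))" using elim by (intro tail_antimono)
    finally show ?case .
  qed
  then have "\<forall>\<^sub>F m in sequentially. (1 / 2) ^ k * exp (- (k * \<alpha> * \<epsilon> * (1 + \<delta>) * real m))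
      \<le> q m ((\<gamma> + \<epsilon>) * real m)"
    by (subst (asm) eventually_sequentially_Suc[of "\<lambda>m. (1 / 2) ^ k * exp (- (k * \<alpha> * \<epsilon> * (1 + \<delta>) * real m))
      \<le> q m ((\<gamma> + \<epsilon>) * real m)"])
  then show ?thesis by (intro exI[of _ "(1 / 2) ^ k"]) auto
qed

end

section \<open>Transfer from the law of the step to the walk\<close>

lemma speed_distr:
  assumes "Y \<in> borel_measurable N"
  shows "speed k (distr N borel Y) (\<lambda>y. y) = speed k N Y"
  using assms
  by (simp add: speed_def rate_function_def log_mgf_def integral_distr nn_integral_distr)

lemma exponential_tail_distr:
  assumes "Y \<in> borel_measurable N"
  shows "exponential_tail (distr N borel Y) (\<lambda>y. y) \<alpha> \<longleftrightarrow> exponential_tail N Y \<alpha>"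
proof -
  have "measure (distr N borel Y) {y. y \<ge> x} = measure N {\<omega> \<in> space N. Y \<omega> \<ge> x}" for x
    using assms by (subst measure_distr) (auto intro!: arg_cong[where f = "measure N"])
  then show ?thesis by (simp add: exponential_tail_def)
qed

theorem theorem3p2:
  fixes k :: nat and N :: "'a measure" and Y :: "'a \<Rightarrow> real"
    and P :: "'b measure" and X :: "nat list \<Rightarrow> 'b \<Rightarrow> real"
    and \<alpha> \<epsilon> \<delta> :: real
  assumes "k \<ge> 2"
    and "prob_space N"
    and "Y \<in> borel_measurable N"
    and "AE \<omega> in N. Y \<omega> \<ge> 0"
    and "\<alpha> > 0"
    and "exponential_tail N Y \<alpha>"
    and "branching_random_walk k N Y P X"
    and "\<epsilon> > 0" and "\<delta> > 0"
  shows "\<exists>c c' :: real. c > 0 \<and> c' > 0 \<and>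
    (\<forall>\<^sub>F m in sequentially.
       c * exp (- (real k * \<alpha> * \<epsilon> * (1 + \<delta>) * real m))
         \<le> measure P {\<omega> \<in> space P. min_position k X m \<omega> \<ge> (speed k N Y + \<epsilon>) * real m} \<and>
       measure P {\<omega> \<in> space P. min_position k X m \<omega> \<ge> (speed k N Y + \<epsilon>) * real m}
         \<le> c' * exp (- (real k * \<alpha> * \<epsilon> * (1 - \<delta>) * real m)))"
proof -
  interpret N: prob_space N by fact
  interpret D: prob_space "distr N borel Y" using assms(3) by (rule N.prob_space_distr)
  interpret exponential_steps "distr N borel Y" k \<alpha>
    using assms by unfold_locales (auto simp: AE_distr_iff exponential_tail_distr)
  have tail: "measure P {\<omega> \<in> space P. min_position k X m \<omega> \<ge> x} = tail (distr N borel Y) k m x" for m x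
    using assms by (intro prob_min_position_ge) auto
  obtain c where c: "c > 0" "\<forall>\<^sub>F m in sequentially. c * exp (- (k * \<alpha> * \<epsilon> * (1 + \<delta>) * real m))
      \<le> tail (distr N borel Y) k m ((speed k N Y + \<epsilon>) * real m)"
    using tail_lower_asymptotics[OF assms(8,9)] speed_distr[OF assms(3)] by auto
  obtain c' where c': "c' > 0" "\<forall>\<^sub>F m in sequentially.
      tail (distr N borel Y) k m ((speed k N Y + \<epsilon>) * real m) \<le> c' * exp (- (k * \<alpha> * \<epsilon> * (1 - \<delta>) * real m))"
    using tail_upper_asymptotics[OF assms(8,9)] speed_distr[OF assms(3)] by auto
  show ?thesis
    unfolding tail using c c' by (intro exI[of _ c] exI[of _ c'] conjI eventually_conj)
qed

end
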